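(* Let $X$ and $Y$ be Tychonoff spaces. The map $\hat{\chi}\colon \hat{P}(X\times Y)\to \hat{P}(X)\times\hat{P}(Y)$ defined by $\hat{\chi}(\lambda)=(\hat{P}\mathrm{pr}_1(\lambda),\hat{P}\mathrm{pr}_2(\lambda))$ is open, where $\hat{P}(X\times Y)$, $\hat{P}(X)$ and $\hat{P}(Y)$ carry the weak-* topology and $\hat{P}(X)\times\hat{P}(Y)$ carries the product topology.
   Context: For a Tychonoff space $Z$, a finite non-negative Borel measure $\mu$ on $Z$ is Radon if $\mu(A)=\sup\{\mu(K)\colon K\subset A,\ K \text{ compact}\}$ for every Borel set $A\subset Z$. $\hat{P}(Z)$ denotes the set of Radon probability measures on $Z$. The weak-* topology on $\hat{P}(Z)$ is the topology with base consisting of the sets $O(\mu,V_1,\dots,V_k,\varepsilon)=\{\nu\in\hat{P}(Z)\colon \nu(V_i)>\mu(V_i)-\varepsilon,\ i=1,\dots,k\}$, where $\mu\in\hat P(Z)$, $V_1,\dots,V_k\subset Z$ are open and $\varepsilon>0$. $\mathrm{pr}_1\colon X\times Y\to X$ and $\mathrm{pr}_2\colon X\times Y\to Y$ are the coordinate projections, and $\hat{P}\mathrm{pr}_i(\lambda)$ denotes the image (push-forward) measure $\lambda\circ \mathrm{pr}_i^{-1}$, i.e. the marginals of $\lambda$. *)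

theory Defs
  imports "HOL-Probability.Probability"
begin

definition tychonoff_space :: "'a topology \<Rightarrow> bool" where
  "tychonoff_space X \<longleftrightarrow> completely_regular_space X \<and> Hausdorff_space X"

definition borel_of :: "'a topology \<Rightarrow> 'a measure" where
  "borel_of X = sigma (topspace X) {U. openin X U}"

definition radon_prob :: "'a topology \<Rightarrow> 'a measure \<Rightarrow> bool" where
  "radon_prob X M \<longleftrightarrow> sets M = sets (borel_of X) \<and> prob_space M \<and>
     (\<forall>A \<in> sets M. emeasure M A = (SUP K \<in> {K. compactin X K \<and> K \<subseteq> A}. emeasure M K))"

definition PR :: "'a topology \<Rightarrow> 'a measure set" where
  "PR X = {M. radon_prob X M}"

definition weak_star_basic :: "'a topology \<Rightarrow> 'a measure \<Rightarrow> 'a set list \<Rightarrow> real \<Rightarrow> 'a measure set" where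
  "weak_star_basic X \<mu> Vs \<epsilon> = {\<nu> \<in> PR X. \<forall>V \<in> set Vs. measure \<nu> V > measure \<mu> V - \<epsilon>}"

definition weak_star :: "'a topology \<Rightarrow> 'a measure topology" where
  "weak_star X = topology_generated_by
     {weak_star_basic X \<mu> Vs \<epsilon> | \<mu> Vs \<epsilon>. \<mu> \<in> PR X \<and> (\<forall>V \<in> set Vs. openin X V) \<and> \<epsilon> > 0}"

definition marginals :: "'a topology \<Rightarrow> 'b topology \<Rightarrow> ('a \<times> 'b) measure \<Rightarrow> 'a measure \<times> 'b measure" where
  "marginals X Y L = (distr L (borel_of X) fst, distr L (borel_of Y) snd)"

end

theory Submission
  imports Defs
begin

text \<open>
  Let \<open>\<lambda>\<close> be a Radon probability with marginals \<open>\<mu>\<close>, \<open>\<nu>\<close>. By inner regularity, all but a little of its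
  mass sits on finitely many rectangles \<open>K p \<times> K' q\<close> of compact sets, contained in open rectangles
  \<open>G p \<times> H q\<close> with disjoint \<open>G p\<close>, disjoint \<open>H q\<close>, that lie in a given open set \<open>W\<close> as soon as they
  carry relevant mass of \<open>W\<close>. If \<open>\<mu>'\<close>, \<open>\<nu>'\<close> give almost as much mass to the \<open>G p\<close>, \<open>H q\<close> as \<open>\<mu>\<close>, \<open>\<nu>\<close>
  do, then the masses \<open>\<lambda> (K p \<times> K' q)\<close>, slightly decreased, can be placed on \<open>G p \<times> H q\<close> by a
  coupling of \<open>\<mu>'\<close> and \<open>\<nu>'\<close> that has a density with respect to their product. The Borel sets of
  \<open>X \<times> Y\<close> may be strictly more than the product \<open>\<sigma>\<close>-algebra, so this product has to be the Radon
  extension \<open>E \<mapsto> \<integral> \<nu>' (E\<^sub>x) d\<mu>'\<close>; sections of open sets have lower semicontinuous measure by the tube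
  lemma.
\<close>

section \<open>Radon probabilities\<close>

lemma sets_borel_of: "sets (borel_of X) = sigma_sets (topspace X) {U. openin X U}"
  unfolding borel_of_def by (rule sets_measure_of) (auto dest: openin_subset)

lemma space_borel_of: "space (borel_of X) = topspace X"
  unfolding borel_of_def by (rule space_measure_of) (auto dest: openin_subset)

lemma openin_borel_of: "openin X U \<Longrightarrow> U \<in> sets (borel_of X)"
  by (simp add: sets_borel_of sigma_sets.Basic)

lemma closedin_borel_of:
  assumes "closedin X C" shows "C \<in> sets (borel_of X)"
proof -
  have "topspace X - (topspace X - C) \<in> sets (borel_of X)"
    using openin_borel_of[of X "topspace X - C"] assms
    by (metis openin_diff openin_topspace sets.compl_sets space_borel_of)
  then show ?thesis
    using closedin_subset[OF assms] by (simp add: double_diff)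
qed

lemma compactin_borel_of: "Hausdorff_space X \<Longrightarrow> compactin X K \<Longrightarrow> K \<in> sets (borel_of X)"
  by (simp add: closedin_borel_of compactin_imp_closedin)

lemma continuous_map_measurable:
  assumes "continuous_map X Y f"
  shows "f \<in> borel_of X \<rightarrow>\<^sub>M borel_of Y"
proof (rule measurable_sigma_sets[OF sets_borel_of])
  show "f \<in> space (borel_of X) \<rightarrow> topspace Y"
    using assms by (auto simp: space_borel_of continuous_map_def)
  fix U assume "U \<in> {U. openin Y U}"
  then show "f -` U \<inter> space (borel_of X) \<in> sets (borel_of X)"
    using openin_continuous_map_preimage[OF assms, of U]
    by (intro openin_borel_of) (simp add: space_borel_of vimage_def Int_def conj_commute)
qed (auto dest: openin_subset)

section \<open>Inner regularity by compact and by sigma-compact sets\<close>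

text \<open>Real-valued form of the supremum condition at a single set \<open>A\<close>, so that
  regularity can be proved set by set and errors can be added up in the reals.\<close>

definition compact_inner_regular :: "'a topology \<Rightarrow> 'a measure \<Rightarrow> 'a set \<Rightarrow> bool" where
  "compact_inner_regular X M A \<longleftrightarrow>
     (\<forall>e>0. \<exists>K. compactin X K \<and> K \<subseteq> A \<and> measure M A < measure M K + e)"

lemma radon_prob_iff:
  "radon_prob X M \<longleftrightarrow> sets M = sets (borel_of X) \<and> prob_space M \<and>
     (\<forall>A \<in> sets M. compact_inner_regular X M A)"
proof -
  have "emeasure M A = (SUP K \<in> {K. compactin X K \<and> K \<subseteq> A}. emeasure M K)
      \<longleftrightarrow> compact_inner_regular X M A" (is "_ = ?S \<longleftrightarrow> _")
    if "prob_space M" and A: "A \<in> sets M" for A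
  proof -
    interpret prob_space M by fact
    have le: "?S \<le> emeasure M A"
      using A by (intro SUP_least emeasure_mono) auto
    show ?thesis
    proof
      assume eq: "emeasure M A = ?S"
      show "compact_inner_regular X M A"
        unfolding compact_inner_regular_def
      proof (intro allI impI)
        fix e :: real assume e: "e > 0"
        show "\<exists>K. compactin X K \<and> K \<subseteq> A \<and> measure M A < measure M K + e"
        \<comment> \<open>If \<open>measure M A < e\<close>, the empty compact set suffices.
          Otherwise \<open>measure M A - e\<close> is nonnegative, and \<open>ennreal\<close> does
          not truncate it.\<close>
        proof (cases "measure M A < e")
          case True
          then show ?thesis by (intro exI[of _ "{}"]) simp
        next
          case False
          have "ennreal (measure M A - e) < emeasure M A"
            using e False by (simp add: emeasure_eq_measure ennreal_less_iff)
          then obtain K where "compactin X K" "K \<subseteq> A" "ennreal (measure M A - e) < emeasure M K"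
            unfolding eq less_SUP_iff by auto
          then show ?thesis
            using False by (intro exI[of _ K]) (simp add: emeasure_eq_measure ennreal_less_iff)
        qed
      qed
    next
      assume R: "compact_inner_regular X M A"
      have "emeasure M A \<le> ?S"
      proof (rule ennreal_le_epsilon)
        fix e :: real assume "e > 0"
        then obtain K where K: "compactin X K" "K \<subseteq> A" "measure M A < measure M K + e"
          using R unfolding compact_inner_regular_def by blast
        then have "emeasure M A \<le> emeasure M K + ennreal e"
          using \<open>e > 0\<close> by (simp add: emeasure_eq_measure flip: ennreal_plus)
        also have "\<dots> \<le> ?S + ennreal e"
          using K by (intro add_right_mono SUP_upper) auto
        finally show "emeasure M A \<le> ?S + ennreal e" .
      qed
      with le show "emeasure M A = ?S" by simp
    qed
  qed
  then show ?thesis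
    unfolding radon_prob_def by metis
qed

text \<open>Exhaustion: the \<open>C n\<close> have mass within \<open>1 / Suc n\<close> of the
  supremum \<open>s\<close> over compact subsets of \<open>A\<close>. A compact \<open>K\<close>
  with substantial mass outside all of them could be joined to some \<open>C n\<close> and would
  exceed \<open>s\<close>. Regularity of \<open>M\<close> is not presupposed, so the lemma can serve
  to establish it.\<close>

lemma maximal_sigma_compact_subset:
  assumes X: "Hausdorff_space X" and M: "finite_measure M" "sets M = sets (borel_of X)"
  obtains C :: "nat \<Rightarrow> 'a set" where "\<And>n. compactin X (C n)" "\<And>n. C n \<subseteq> A"
    "\<And>K. compactin X K \<Longrightarrow> K \<subseteq> A \<Longrightarrow> measure M (K - (\<Union>n. C n)) = 0"
proof -
  interpret finite_measure M by fact
  define S where "S = {K. compactin X K \<and> K \<subseteq> A}"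
  define s where "s = (SUP K\<in>S. measure M K)"
  have meas: "K \<in> sets M" if "compactin X K" for K
    using compactin_borel_of[OF X that] M by simp
  have bdd: "bdd_above (measure M ` S)"
    by (auto intro!: bdd_aboveI[of _ "measure M (space M)"] bounded_measure)
  have "{} \<in> S" by (simp add: S_def)
  have "\<exists>K\<in>S. s - 1 / Suc n < measure M K" for n
    using less_cSUP_iff[of S "measure M" "s - 1 / Suc n"] bdd \<open>{} \<in> S\<close>
    by (fastforce simp: s_def)
  then obtain C where C: "\<And>n. C n \<in> S" "\<And>n. s - 1 / Suc n < measure M (C n)"
    by metis
  have "measure M (K - (\<Union>n. C n)) = 0" if K: "compactin X K" "K \<subseteq> A" for K
  proof -
    have "measure M (K - (\<Union>n. C n)) < 1 / Suc n" for n
    proof -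
      have Cn: "C n \<in> sets M" using C(1)[of n] meas by (simp add: S_def)
      have "K \<union> C n \<in> S"
        using K C(1)[of n] by (simp add: S_def compactin_Un)
      then have "measure M (K \<union> C n) \<le> s"
        unfolding s_def using bdd by (rule cSUP_upper)
      moreover have "measure M (K \<union> C n) = measure M (C n) + measure M (K - C n)"
        using finite_measure_Union[of "C n" "K - C n"] Cn meas[OF K(1)]
        by (simp add: Un_commute Un_Diff_cancel sets.Diff)
      moreover have "measure M (K - (\<Union>n. C n)) \<le> measure M (K - C n)"
        using Cn meas[OF K(1)] by (intro finite_measure_mono) auto
      ultimately show ?thesis using C(2)[of n] by linarith
    qed
    then have "\<not> 0 < measure M (K - (\<Union>n. C n))"
      using reals_Archimedean by (metis inverse_eq_divide less_asym)
    then show ?thesis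
      using measure_nonneg[of M "K - (\<Union>n. C n)"] by linarith
  qed
  with C(1) show thesis
    by (intro that[of C]) (auto simp: S_def)
qed

text \<open>Finite unions of the \<open>C n\<close> are compact, and by continuity from below their
  masses tend to that of \<open>A\<close>.\<close>

lemma compact_inner_regularI_sigma_compact:
  assumes X: "Hausdorff_space X" and M: "finite_measure M" "sets M = sets (borel_of X)"
    and A: "A \<in> sets M"
    and C: "\<And>n::nat. compactin X (C n)" "\<And>n. C n \<subseteq> A" "measure M (A - (\<Union>n. C n)) = 0"
  shows "compact_inner_regular X M A"
  unfolding compact_inner_regular_def
proof (intro allI impI)
  interpret finite_measure M by fact
  have meas[measurable]: "C n \<in> sets M" for n
    using compactin_borel_of[OF X C(1)] M by simp
  fix e :: real assume e: "e > 0"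
  define D where "D n = (\<Union>i\<le>n. C i)" for n
  have D[measurable]: "D n \<in> sets M" for n unfolding D_def by simp
  have UD: "(\<Union>n. D n) = (\<Union>n. C n)" by (auto simp: D_def)
  have "incseq D" by (force simp: D_def incseq_def)
  then have "(\<lambda>n. measure M (D n)) \<longlonglongrightarrow> measure M (\<Union>n. D n)"
    by (intro finite_Lim_measure_incseq) auto
  moreover have "measure M (\<Union>n. D n) = measure M A"
  proof -
    have "measure M (A - (\<Union>n. C n)) = measure M A - measure M (\<Union>n. C n)"
      using A C(2) by (intro finite_measure_Diff) auto
    then show ?thesis using C(3) UD by simp
  qed
  ultimately have "eventually (\<lambda>n. measure M A - e < measure M (D n)) sequentially"
    using e by (intro order_tendstoD(1)[where y = "measure M A"]) auto
  then obtain n where "measure M A - e < measure M (D n)"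
    by (auto simp: eventually_sequentially)
  moreover have "compactin X (D n)"
    unfolding D_def using C(1) by (intro compactin_Union) auto
  moreover have "D n \<subseteq> A" using C(2) by (auto simp: D_def)
  ultimately show "\<exists>K. compactin X K \<and> K \<subseteq> A \<and> measure M A < measure M K + e"
    by (intro exI[of _ "D n"]) auto
qed

text \<open>Converse of the preceding lemma: a maximal sigma-compact subset absorbs every compact
  \<open>K \<subseteq> A\<close> up to a null set, and by regularity such a \<open>K\<close> misses
  arbitrarily little of \<open>A\<close>.\<close>

lemma compact_inner_regular_sigma_compact:
  assumes X: "Hausdorff_space X" and M: "finite_measure M" "sets M = sets (borel_of X)"
    and A: "A \<in> sets M" and R: "compact_inner_regular X M A"
  obtains C :: "nat \<Rightarrow> 'a set" where "\<And>n. compactin X (C n)" "\<And>n. C n \<subseteq> A"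
    "measure M (A - (\<Union>n. C n)) = 0"
proof -
  interpret finite_measure M by fact
  obtain C :: "nat \<Rightarrow> 'a set" where C: "\<And>n. compactin X (C n)" "\<And>n. C n \<subseteq> A"
    "\<And>K. compactin X K \<Longrightarrow> K \<subseteq> A \<Longrightarrow> measure M (K - (\<Union>n. C n)) = 0"
    by (rule maximal_sigma_compact_subset[OF X M, of A]) blast
  have meas: "K \<in> sets M" if "compactin X K" for K
    using compactin_borel_of[OF X that] M by simp
  have Cm: "(\<Union>n. C n) \<in> sets M" using meas[OF C(1)] by auto
  have "measure M (A - (\<Union>n. C n)) \<le> e" if e: "e > 0" for e
  proof -
    obtain K where K: "compactin X K" "K \<subseteq> A" "measure M A < measure M K + e"
      using R e unfolding compact_inner_regular_def by blast
    have "measure M (A - (\<Union>n. C n)) \<le> measure M ((A - K) \<union> (K - (\<Union>n. C n)))"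
      using meas[OF K(1)] Cm A by (intro finite_measure_mono) auto
    also have "\<dots> \<le> measure M (A - K) + measure M (K - (\<Union>n. C n))"
      using meas[OF K(1)] Cm A by (intro measure_Un_le) auto
    also have "\<dots> \<le> e"
      using C(3)[OF K(1,2)] finite_measure_Diff[OF A meas[OF K(1)] K(2)] K(3) by simp
    finally show ?thesis .
  qed
  then have "measure M (A - (\<Union>n. C n)) = 0"
    using field_le_epsilon[of "measure M (A - (\<Union>n. C n))" 0] by (simp add: measure_le_0_iff)
  with C(1,2) show thesis by (rule that)
qed

text \<open>In sigma-compact form, regularity at \<open>A\<close> only says that some remainder is
  null, and null sets of \<open>M\<close> are null for \<open>N\<close>. This makes measures given
  by a density with respect to the Radon product Radon again.\<close>

lemma radon_prob_absolutely_continuous: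
  assumes X: "Hausdorff_space X" and M: "radon_prob X M"
    and N: "prob_space N" "sets N = sets M" "absolutely_continuous M N"
  shows "radon_prob X N"
  unfolding radon_prob_iff
proof (intro conjI ballI)
  have sM: "sets M = sets (borel_of X)" and pM: "prob_space M"
    using M by (auto simp: radon_prob_def)
  show sN: "sets N = sets (borel_of X)" using N sM by simp
  fix A assume A: "A \<in> sets N"
  interpret M: prob_space M by fact
  interpret N: prob_space N by fact
  have AM: "A \<in> sets M" "compact_inner_regular X M A"
    using A N M by (auto simp: radon_prob_iff)
  obtain C :: "nat \<Rightarrow> 'a set" where C: "\<And>n. compactin X (C n)" "\<And>n. C n \<subseteq> A"
    "measure M (A - (\<Union>n. C n)) = 0"
    using compact_inner_regular_sigma_compact[OF X M.finite_measure_axioms sM AM] by metis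
  have "A - (\<Union>n. C n) \<in> sets M"
    using AM(1) compactin_borel_of[OF X C(1)] sM by auto
  then have "emeasure N (A - (\<Union>n. C n)) = 0"
    using C(3) by (intro absolutely_continuousD[OF N(3)]) (auto simp: M.emeasure_eq_measure)
  then show "compact_inner_regular X N A"
    using C(1,2)
    by (intro compact_inner_regularI_sigma_compact[OF X N.finite_measure_axioms sN A, of C])
       (auto simp: N.emeasure_eq_measure)
qed (fact N(1))

text \<open>The sets that can be squeezed between a compact and an open set of nearly equal mass
  form a sigma-algebra; regularity at open sets puts the generators into it.\<close>

lemma radon_prob_if_open_inner_regular:
  assumes X: "Hausdorff_space X" and M: "prob_space M" "sets M = sets (borel_of X)"
    and op: "\<And>U. openin X U \<Longrightarrow> compact_inner_regular X M U"
  shows "radon_prob X M"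
proof -
  interpret prob_space M by fact
  have mc: "K \<in> sets M" if "compactin X K" for K
    using compactin_borel_of[OF X that] M by simp
  have mo: "U \<in> sets M" if "openin X U" for U
    using openin_borel_of[OF that] M by simp
  define approx where "approx A e C U \<longleftrightarrow>
    compactin X C \<and> openin X U \<and> C \<subseteq> A \<and> A \<subseteq> U \<and> measure M (U - C) < e" for A e C U
  have "\<forall>e>0. \<exists>C U. approx A e C U"
    if "A \<in> sigma_sets (topspace X) {U. openin X U}" for A
    using that
  proof (induction rule: sigma_sets.induct)
    case (Basic U)
    then have U: "openin X U" by simp
    show ?case
    proof (intro allI impI)
      fix e :: real assume "e > 0"
      then obtain K where K: "compactin X K" "K \<subseteq> U" "measure M U < measure M K + e"
        using op[OF U] unfolding compact_inner_regular_def by blast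
      then have "approx U e K U"
        using U mc mo by (simp add: approx_def finite_measure_Diff)
      then show "\<exists>C U'. approx U e C U'" by blast
    qed
  next
    case Empty
    have "approx {} e {} {}" if "e > 0" for e
      using that by (simp add: approx_def)
    then show ?case by blast
  next
    case (Compl A)
    show ?case
    proof (intro allI impI)
      fix e :: real assume "e > 0"
      then have e: "e / 2 > 0" by simp
      then obtain C U where CU: "compactin X C" "openin X U" "C \<subseteq> A" "A \<subseteq> U"
          "measure M (U - C) < e / 2"
        using Compl.IH unfolding approx_def by meson
      obtain T where T: "compactin X T" "T \<subseteq> topspace X"
          "measure M (topspace X) < measure M T + e / 2"
        using op[OF openin_topspace] e unfolding compact_inner_regular_def by blast
      \<comment> \<open>The complement of \<open>U\<close> is only closed. Cutting it down to a
        compact \<open>T\<close> that carries all but \<open>e / 2\<close> of the total mass makes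
        it compact.\<close>
      have "compactin X (T - U)"
      proof -
        have "compactin X (T \<inter> (topspace X - U))"
          using T(1) CU(2) by (intro compact_Int_closedin) auto
        moreover have "T \<inter> (topspace X - U) = T - U" using T(2) by blast
        ultimately show ?thesis by simp
      qed
      moreover have "openin X (topspace X - C)"
        using compactin_imp_closedin[OF X CU(1)] by (simp add: openin_diff)
      moreover have "measure M ((topspace X - C) - (T - U)) < e"
      proof -
        have "measure M ((topspace X - C) - (T - U)) \<le> measure M ((topspace X - T) \<union> (U - C))"
          using mc[OF T(1)] mc[OF CU(1)] mo[OF CU(2)] mo[OF openin_topspace]
          by (intro finite_measure_mono) auto
        also have "\<dots> \<le> measure M (topspace X - T) + measure M (U - C)"
          using mc[OF T(1)] mc[OF CU(1)] mo[OF CU(2)] mo[OF openin_topspace]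
          by (intro measure_Un_le) auto
        also have "measure M (topspace X - T) < e / 2"
          using T mc[OF T(1)] mo[OF openin_topspace] by (simp add: finite_measure_Diff)
        finally show ?thesis using CU(5) by linarith
      qed
      ultimately have "approx (topspace X - A) e (T - U) (topspace X - C)"
        using CU T unfolding approx_def by auto
      then show "\<exists>C U. approx (topspace X - A) e C U" by blast
    qed
  next
    case (Union A)
    show ?case
    proof (intro allI impI)
      fix e :: real assume "e > 0"
      \<comment> \<open>The tolerances sum to \<open>e / 2\<close>. The other half of
        \<open>e\<close> is spent below on replacing the sigma-compact union \<open>D\<close> by a
        compact \<open>K\<close>.\<close>
      define d where "d n = e / 2 * (1/2) ^ Suc n" for n
      have d: "d n > 0" for n using \<open>e > 0\<close> by (simp add: d_def)
      have dsum: "d sums (e / 2)"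
        unfolding d_def using sums_mult[OF power_half_series, of "e / 2"] by simp
      have "\<exists>C U. approx (A n) (d n) C U" for n
        using Union.IH d by blast
      then obtain C U where CU: "\<And>n. approx (A n) (d n) (C n) (U n)" by metis
      have Cm: "C n \<in> sets M" and Um: "U n \<in> sets M" for n
        using CU mc mo by (auto simp: approx_def)
      define D where "D = (\<Union>n. C n)"
      define V where "V = (\<Union>n. U n)"
      have DV: "D \<in> sets M" "V \<in> sets M" using Cm Um by (auto simp: D_def V_def)
      have "measure M (V - D) \<le> measure M (\<Union>n. U n - C n)"
        using Cm Um by (intro finite_measure_mono) (auto simp: V_def D_def)
      also have "\<dots> \<le> (\<Sum>n. measure M (U n - C n))"
        using CU Cm Um sums_summable[OF dsum]
        by (intro finite_measure_subadditive_countably)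
           (auto simp: approx_def less_imp_le intro!: summable_comparison_test'[of d 0])
      also have "\<dots> \<le> suminf d"
        using CU Cm Um sums_summable[OF dsum]
        by (intro suminf_le)
           (auto simp: approx_def less_imp_le intro!: summable_comparison_test'[of d 0])
      finally have VD: "measure M (V - D) \<le> e / 2"
        using sums_unique[OF dsum] by simp
      have "compact_inner_regular X M D"
        using CU DV
        by (intro compact_inner_regularI_sigma_compact[OF X finite_measure_axioms M(2), of D C])
           (auto simp: approx_def D_def)
      then obtain K where K: "compactin X K" "K \<subseteq> D" "measure M D < measure M K + e / 2"
        using \<open>e > 0\<close> unfolding compact_inner_regular_def by (meson half_gt_zero)
      have "measure M (V - K) \<le> measure M ((V - D) \<union> (D - K))"
        using DV mc[OF K(1)] by (intro finite_measure_mono) auto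
      also have "\<dots> \<le> measure M (V - D) + measure M (D - K)"
        using DV mc[OF K(1)] by (intro measure_Un_le) auto
      also have "\<dots> < e"
        using VD K DV mc[OF K(1)] by (simp add: finite_measure_Diff)
      finally have "approx (\<Union>n. A n) e K V"
        using K CU unfolding approx_def V_def D_def by blast
      then show "\<exists>C U. approx (\<Union>n. A n) e C U" by blast
    qed
  qed
  moreover have "measure M A < measure M C + e" if "A \<in> sets M" "approx A e C U" for A e C U
  proof -
    have "measure M A - measure M C = measure M (A - C)"
      using that mc by (intro finite_measure_Diff[symmetric]) (auto simp: approx_def)
    also have "\<dots> \<le> measure M (U - C)"
      using that mc mo by (intro finite_measure_mono) (auto simp: approx_def)
    finally show ?thesis using that by (simp add: approx_def)
  qed
  ultimately have "compact_inner_regular X M A" if "A \<in> sets M" for A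
    using that M(2) unfolding compact_inner_regular_def sets_borel_of
    by (metis approx_def)
  then show ?thesis using M unfolding radon_prob_iff by blast
qed

section \<open>Null sets of Radon measures\<close>

lemma radon_prob_null_compact:
  assumes "radon_prob X M" "A \<in> sets M"
    and "\<And>K. compactin X K \<Longrightarrow> K \<subseteq> A \<Longrightarrow> measure M K = 0"
  shows "measure M A = 0"
proof (rule ccontr)
  assume "measure M A \<noteq> 0"
  then have "measure M A > 0" by (simp add: zero_less_measure_iff)
  \<comment> \<open>Regularity with tolerance \<open>measure M A\<close> itself yields a compact
    subset of positive mass.\<close>
  then obtain K where "compactin X K" "K \<subseteq> A" "measure M A < measure M K + measure M A"
    using assms(1,2) unfolding radon_prob_iff compact_inner_regular_def by blast
  with assms(3) show False by simp
qed

text \<open>A compact \<open>K \<subseteq> A\<close> is covered by finitely many of the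
  neighbourhoods in which \<open>A\<close> is null, hence is null. Inner regularity thus replaces
  the countable subcover that a general space need not provide.\<close>

lemma radon_prob_null_local:
  assumes M: "radon_prob X M" and A: "A \<in> sets M"
    and loc: "\<And>x. x \<in> A \<Longrightarrow> \<exists>U. openin X U \<and> x \<in> U \<and> measure M (A \<inter> U) = 0"
  shows "measure M A = 0"
proof (rule radon_prob_null_compact[OF M A])
  interpret prob_space M using M by (simp add: radon_prob_def)
  fix K assume K: "compactin X K" "K \<subseteq> A"
  let ?\<U> = "{U. openin X U \<and> measure M (A \<inter> U) = 0}"
  have "K \<subseteq> \<Union>?\<U>" using K(2) loc by blast
  then obtain \<F> where \<F>: "finite \<F>" "\<F> \<subseteq> ?\<U>" "K \<subseteq> \<Union>\<F>"
    using compactinD[OF K(1), of ?\<U>] by auto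
  have meas: "A \<inter> U \<in> sets M" if "U \<in> \<F>" for U
    using that \<F>(2) M A openin_borel_of[of X U] by (auto simp: radon_prob_def)
  have "measure M K \<le> measure M (\<Union>U\<in>\<F>. A \<inter> U)"
    using K \<F> meas by (intro finite_measure_mono sets.finite_UN) auto
  also have "\<dots> \<le> (\<Sum>U\<in>\<F>. measure M (A \<inter> U))"
    using \<F> meas by (intro finite_measure_subadditive_finite) auto
  also have "\<dots> = 0"
    using \<F> by (intro sum.neutral) auto
  finally show "measure M K = 0" by (simp add: measure_le_0_iff)
qed

section \<open>The Radon product measure\<close>

lemma radon_prob_space: "radon_prob X M \<Longrightarrow> space M = topspace X"
  unfolding radon_prob_def by (metis sets_eq_imp_space_eq space_borel_of)

text \<open>The kernel places \<open>N\<close> on the fibre over \<open>x\<close>, as a measure on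
  the Borel sets of the product topology. Integrating it against \<open>M\<close> yields a measure
  on all these Borel sets, beyond the sigma-algebra generated by rectangles.\<close>

definition radon_product ::
    "'a topology \<Rightarrow> 'b topology \<Rightarrow> 'a measure \<Rightarrow> 'b measure \<Rightarrow> ('a \<times> 'b) measure" where
  "radon_product X Y M N = M \<bind> (\<lambda>x. distr N (borel_of (prod_topology X Y)) (Pair x))"

lemma Pair_measurable_borel_of:
  assumes "x \<in> topspace X"
  shows "Pair x \<in> borel_of Y \<rightarrow>\<^sub>M borel_of (prod_topology X Y)"
  using assms by (intro continuous_map_measurable continuous_map_pairedI) auto

text \<open>Lower semicontinuity: a compact set of mass above \<open>q\<close> inside the section at
  \<open>x\<close> stays inside all nearby sections, by the tube lemma.\<close>

lemma openin_measure_section_greater: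
  assumes N: "radon_prob Y N" and W: "openin (prod_topology X Y) W"
  shows "openin X {x \<in> topspace X. q < measure N (Pair x -` W)}"
proof (subst openin_subopen, intro ballI)
  interpret N: prob_space N using N by (simp add: radon_prob_def)
  have sN: "sets N = sets (borel_of Y)" using N by (simp add: radon_prob_def)
  have secW: "Pair x -` W \<in> sets N" if "x \<in> topspace X" for x
    using measurable_sets[OF Pair_measurable_borel_of[OF that] openin_borel_of[OF W]]
      openin_subset[OF W] sN
    by (auto simp: space_borel_of Int_absorb2 subset_iff)
  fix x assume "x \<in> {x \<in> topspace X. q < measure N (Pair x -` W)}"
  then have x: "x \<in> topspace X" "q < measure N (Pair x -` W)" by auto
  \<comment> \<open>This excess over \<open>q\<close> is the tolerance for inner regularity, so that
    the compact \<open>K\<close> still satisfies \<open>q < measure N K\<close>.\<close>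
  then have "measure N (Pair x -` W) - q > 0" by simp
  then obtain K where K: "compactin Y K" "K \<subseteq> Pair x -` W"
      "measure N (Pair x -` W) < measure N K + (measure N (Pair x -` W) - q)"
    using N secW[OF x(1)] unfolding radon_prob_iff compact_inner_regular_def by meson
  have "{x} \<times> K \<subseteq> W" using K(2) by auto
  from tube_lemma_right[OF W K(1) x(1) this]
  obtain U V where UV: "openin X U" "openin Y V" "x \<in> U" "K \<subseteq> V" "U \<times> V \<subseteq> W"
    by blast
  have "q < measure N (Pair x' -` W)" if "x' \<in> U" for x'
  proof -
    have "x' \<in> topspace X" using that UV(1) openin_subset by blast
    have "measure N K \<le> measure N (Pair x' -` W)"
      using that UV secW[OF \<open>x' \<in> topspace X\<close>] by (intro N.finite_measure_mono) auto
    then show ?thesis using K(3) by linarith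
  qed
  then show "\<exists>T. openin X T \<and> x \<in> T \<and> T \<subseteq> {x \<in> topspace X. q < measure N (Pair x -` W)}"
    using UV openin_subset[OF UV(1)] by (intro exI[of _ U]) auto
qed

context
  fixes X :: "'a topology" and Y :: "'b topology" and M N
  assumes M: "radon_prob X M" and N: "radon_prob Y N"
begin

section \<open>Sections, the fibre kernel and iterated integration\<close>

lemma Pair_measurable:
  assumes "x \<in> topspace X"
  shows "Pair x \<in> N \<rightarrow>\<^sub>M borel_of (prod_topology X Y)"
  using Pair_measurable_borel_of[OF assms, of Y] N measurable_cong_sets[OF _ refl, of N "borel_of Y"]
  by (auto simp: radon_prob_def)

lemma vimage_Pair_sets:
  assumes "x \<in> topspace X" and E: "E \<in> sets (borel_of (prod_topology X Y))"
  shows "Pair x -` E \<in> sets N"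
proof -
  have "Pair x -` E \<inter> space (borel_of Y) = Pair x -` E"
    using sets.sets_into_space[OF E] by (auto simp: space_borel_of)
  then show ?thesis
    using measurable_sets[OF Pair_measurable_borel_of[OF assms(1), of Y] E] N
    by (simp add: radon_prob_def)
qed

lemma emeasure_section_kernel:
  assumes "x \<in> topspace X" and E: "E \<in> sets (borel_of (prod_topology X Y))"
  shows "emeasure (distr N (borel_of (prod_topology X Y)) (Pair x)) E = emeasure N (Pair x -` E)"
proof -
  have "Pair x -` E \<inter> space N = Pair x -` E"
    using sets.sets_into_space[OF vimage_Pair_sets[OF assms]] by blast
  then show ?thesis
    using E Pair_measurable[OF assms(1)] by (simp add: emeasure_distr)
qed

text \<open>Open sets generate the Borel sets and are stable under intersection, so evaluation at
  open sets decides measurability of the kernel. There it holds by lower semicontinuity of the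
  section masses.\<close>

lemma section_kernel_measurable:
  "(\<lambda>x. distr N (borel_of (prod_topology X Y)) (Pair x))
     \<in> M \<rightarrow>\<^sub>M subprob_algebra (borel_of (prod_topology X Y))"
proof -
  let ?Z = "prod_topology X Y"
  let ?\<kappa> = "\<lambda>x. distr N (borel_of ?Z) (Pair x)"
  have sM: "sets M = sets (borel_of X)" using M by (auto simp: radon_prob_def)
  note spM = radon_prob_space[OF M]
  interpret N: prob_space N using N by (simp add: radon_prob_def)
  have prob: "prob_space (?\<kappa> x)" if "x \<in> topspace X" for x
    using that by (intro N.prob_space_distr Pair_measurable)
  have meas: "(\<lambda>x. emeasure (?\<kappa> x) W) \<in> borel_measurable M" if W: "openin ?Z W" for W
  proof -
    have "(\<lambda>x. measure N (Pair x -` W)) \<in> borel_measurable M"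
      unfolding borel_measurable_iff_greater spM sM
      using openin_borel_of[OF openin_measure_section_greater[OF N W]] by blast
    then have "(\<lambda>x. ennreal (measure N (Pair x -` W))) \<in> borel_measurable M" by measurable
    then show ?thesis
      by (rule measurable_cong[THEN iffD1, rotated])
         (simp add: spM emeasure_section_kernel openin_borel_of[OF W] N.emeasure_eq_measure)
  qed
  show ?thesis
  proof (rule measurable_subprob_algebra_generated[OF sets_borel_of])
    show "Int_stable {U. openin ?Z U}" by (auto simp: Int_stable_def)
    show "{U. openin ?Z U} \<subseteq> Pow (topspace ?Z)" using openin_subset by blast
    show "subprob_space (?\<kappa> x)" if "x \<in> space M" for x
      using prob that spM by (simp add: prob_space_imp_subprob_space)
  qed (use meas meas[OF openin_topspace] in auto)
qed

lemma sets_radon_product: "sets (radon_product X Y M N) = sets (borel_of (prod_topology X Y))"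
  unfolding radon_product_def
  using M by (intro sets_bind) (auto simp: radon_prob_def prob_space.not_empty)

lemma prob_space_radon_product: "prob_space (radon_product X Y M N)"
proof -
  interpret M: prob_space M using M by (simp add: radon_prob_def)
  interpret N: prob_space N using N by (simp add: radon_prob_def)
  note spM = radon_prob_space[OF M]
  show ?thesis
    unfolding radon_product_def
    by (intro M.prob_space_bind[OF _ section_kernel_measurable] AE_I2 N.prob_space_distr
          Pair_measurable) (simp add: spM)
qed

lemma emeasure_radon_product:
  assumes E: "E \<in> sets (borel_of (prod_topology X Y))"
  shows "emeasure (radon_product X Y M N) E = (\<integral>\<^sup>+x. emeasure N (Pair x -` E) \<partial>M)"
proof -
  interpret M: prob_space M using M by (simp add: radon_prob_def)
  note spM = radon_prob_space[OF M]
  have "emeasure (radon_product X Y M N) E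
      = (\<integral>\<^sup>+x. emeasure (distr N (borel_of (prod_topology X Y)) (Pair x)) E \<partial>M)"
    unfolding radon_product_def
    by (rule emeasure_bind[OF M.not_empty section_kernel_measurable E])
  also have "\<dots> = (\<integral>\<^sup>+x. emeasure N (Pair x -` E) \<partial>M)"
    by (intro nn_integral_cong emeasure_section_kernel E) (simp add: spM)
  finally show ?thesis .
qed

lemma nn_integral_radon_product:
  assumes f: "f \<in> borel_measurable (borel_of (prod_topology X Y))"
  shows "(\<integral>\<^sup>+z. f z \<partial>radon_product X Y M N) = (\<integral>\<^sup>+x. \<integral>\<^sup>+y. f (x, y) \<partial>N \<partial>M)"
proof -
  note spM = radon_prob_space[OF M]
  have "(\<integral>\<^sup>+z. f z \<partial>radon_product X Y M N)
      = (\<integral>\<^sup>+x. \<integral>\<^sup>+z. f z \<partial>distr N (borel_of (prod_topology X Y)) (Pair x) \<partial>M)"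
    unfolding radon_product_def
    by (rule nn_integral_bind[OF f section_kernel_measurable])
  also have "\<dots> = (\<integral>\<^sup>+x. \<integral>\<^sup>+y. f (x, y) \<partial>N \<partial>M)"
    using f by (intro nn_integral_cong nn_integral_distr Pair_measurable) (auto simp: spM)
  finally show ?thesis .
qed

lemma section_measure_measurable:
  assumes E: "E \<in> sets (borel_of (prod_topology X Y))"
  shows "(\<lambda>x. measure N (Pair x -` E)) \<in> borel_measurable M"
proof -
  note spM = radon_prob_space[OF M]
  have "(\<lambda>x. emeasure (distr N (borel_of (prod_topology X Y)) (Pair x)) E) \<in> borel_measurable M"
    using section_kernel_measurable E by (rule measurable_emeasure_kernel)
  then have "(\<lambda>x. enn2real (emeasure (distr N (borel_of (prod_topology X Y)) (Pair x)) E))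
      \<in> borel_measurable M" by measurable
  then show ?thesis
    by (rule measurable_cong[THEN iffD1, rotated])
       (simp add: spM emeasure_section_kernel E measure_def)
qed

text \<open>An open set \<open>W\<close> agrees up to a null set with a maximal \<open>\<sigma>\<close>-compact \<open>D \<subseteq> W\<close>: near a point where
  \<open>N (D\<^sub>x) < q < N (W\<^sub>x)\<close> the tube lemma gives \<open>U \<times> L \<subseteq> W\<close> with \<open>L\<close> compact and \<open>N L > q\<close>, and a
  non-null compact set \<open>K\<close> of such points in \<open>U\<close> would make \<open>K \<times> L\<close> contradict maximality.\<close>

lemma radon_prob_radon_product:
  assumes X: "Hausdorff_space X" and Y: "Hausdorff_space Y"
  shows "radon_prob (prod_topology X Y) (radon_product X Y M N)"
proof -
  let ?Z = "prod_topology X Y"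
  let ?P = "radon_product X Y M N"
  have Z: "Hausdorff_space ?Z" using X Y by (simp add: Hausdorff_space_prod_topology)
  interpret M: prob_space M using M by (simp add: radon_prob_def)
  interpret N: prob_space N using N by (simp add: radon_prob_def)
  interpret P: prob_space ?P by (rule prob_space_radon_product)
  note sP = sets_radon_product
  have sM: "sets M = sets (borel_of X)" and sN: "sets N = sets (borel_of Y)"
    using M N by (auto simp: radon_prob_def)
  note spM = radon_prob_space[OF M]
  show ?thesis
  proof (rule radon_prob_if_open_inner_regular[OF Z P.prob_space_axioms sP])
    fix W assume W: "openin ?Z W"
    obtain C :: "nat \<Rightarrow> ('a \<times> 'b) set" where C: "\<And>n. compactin ?Z (C n)" "\<And>n. C n \<subseteq> W"
      "\<And>K. compactin ?Z K \<Longrightarrow> K \<subseteq> W \<Longrightarrow> measure ?P (K - (\<Union>n. C n)) = 0"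
      by (rule maximal_sigma_compact_subset[OF Z P.finite_measure_axioms sP, of W]) blast
    define D where "D = (\<Union>n. C n)"
    have Wm: "W \<in> sets (borel_of ?Z)" using W by (rule openin_borel_of)
    have Dm: "D \<in> sets (borel_of ?Z)"
      using compactin_borel_of[OF Z C(1)] by (auto simp: D_def)
    define f where "f x = measure N (Pair x -` W)" for x
    define g where "g x = measure N (Pair x -` D)" for x
    have [measurable]: "f \<in> borel_measurable M" "g \<in> borel_measurable M"
      unfolding f_def g_def by (intro section_measure_measurable Wm Dm)+
    have null: "measure M {x \<in> space M. g x < q \<and> q < f x} = 0" (is "measure M ?A = 0") for q
    proof (rule radon_prob_null_local[OF M])
      show A: "?A \<in> sets M" by measurable
      fix x assume "x \<in> ?A"
      then have x: "x \<in> topspace X" "q < f x" by (auto simp: spM)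
      then have "f x - q > 0" by simp
      then obtain L where L: "compactin Y L" "L \<subseteq> Pair x -` W" "f x < measure N L + (f x - q)"
        using N vimage_Pair_sets[OF x(1) Wm]
        unfolding radon_prob_iff compact_inner_regular_def f_def by meson
      have "{x} \<times> L \<subseteq> W" using L(2) by auto
      from tube_lemma_right[OF W L(1) x(1) this]
      obtain U V where UV: "openin X U" "openin Y V" "x \<in> U" "L \<subseteq> V" "U \<times> V \<subseteq> W"
        by blast
      have Lm: "L \<in> sets N" using compactin_borel_of[OF Y L(1)] sN by simp
      have "measure M (?A \<inter> U) = 0"
      proof (rule radon_prob_null_compact[OF M])
        show "?A \<inter> U \<in> sets M" using A openin_borel_of[OF UV(1)] sM by auto
        fix K assume K: "compactin X K" "K \<subseteq> ?A \<inter> U"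
        have Km: "K \<in> sets M" using compactin_borel_of[OF X K(1)] sM by simp
        have KL: "compactin ?Z (K \<times> L)" using K(1) L(1) by (simp add: compactin_Times)
        have KLm: "K \<times> L - D \<in> sets (borel_of ?Z)"
          using compactin_borel_of[OF Z KL] Dm by auto
        \<comment> \<open>\<open>K \<times> L\<close> is a compact subset of \<open>W\<close>, since
          it lies in the tube \<open>U \<times> V\<close>; maximality of \<open>D\<close> applies to
          it.\<close>
        have "measure ?P (K \<times> L - D) = 0"
          using C(3)[OF KL] K(2) UV by (fastforce simp: D_def)
        then have "(\<integral>\<^sup>+x. emeasure N (Pair x -` (K \<times> L - D)) \<partial>M) = 0"
          using emeasure_radon_product[OF KLm] by (simp add: P.emeasure_eq_measure)
        moreover have "(\<lambda>x. emeasure N (Pair x -` (K \<times> L - D))) \<in> borel_measurable M"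
          using section_measure_measurable[OF KLm] unfolding N.emeasure_eq_measure by measurable
        ultimately have "AE x in M. emeasure N (Pair x -` (K \<times> L - D)) = 0"
          by (simp add: nn_integral_0_iff_AE)
        \<comment> \<open>Over a point of \<open>K\<close> this section has mass at least
          \<open>measure N L - g x\<close>, which is positive because
          \<open>g x < q < measure N L\<close>. A null integral therefore forces \<open>K\<close> to
          be null.\<close>
        moreover have "emeasure N (Pair x -` (K \<times> L - D)) \<noteq> 0" if "x \<in> K" for x
        proof -
          have xA: "x \<in> topspace X" "g x < q" using that K(2) spM by auto
          have Dx: "Pair x -` D \<in> sets N" by (rule vimage_Pair_sets[OF xA(1) Dm])
          have "measure N L \<le> measure N (Pair x -` D \<union> (L - Pair x -` D))"
            using Lm Dx by (intro N.finite_measure_mono) auto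
          also have "\<dots> \<le> g x + measure N (L - Pair x -` D)"
            unfolding g_def using Lm Dx by (intro measure_Un_le) auto
          finally have "measure N (L - Pair x -` D) > 0" using L(3) xA(2) by linarith
          moreover have "Pair x -` (K \<times> L - D) = L - Pair x -` D" using that by auto
          ultimately show ?thesis by (simp add: N.emeasure_eq_measure)
        qed
        ultimately have "AE x in M. x \<notin> K" by (auto elim: eventually_mono)
        then show "measure M K = 0"
          using AE_iff_null_sets[OF Km] by (auto simp: null_sets_def M.emeasure_eq_measure)
      qed
      then show "\<exists>U. openin X U \<and> x \<in> U \<and> measure M (?A \<inter> U) = 0"
        using UV by blast
    qed
    \<comment> \<open>Rational levels suffice: \<open>g x < f x\<close> leaves a rational strictly
      between, and countably many null sets have a null union.\<close>
    have "AE x in M. \<not> (g x < of_rat q \<and> of_rat q < f x)" for q :: rat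
    proof -
      have "{x \<in> space M. g x < of_rat q \<and> of_rat q < f x} \<in> null_sets M"
        using null by (auto simp: null_sets_def M.emeasure_eq_measure)
      then show ?thesis by (rule AE_I') auto
    qed
    then have "AE x in M. \<forall>q. \<not> (g x < of_rat q \<and> of_rat q < f x)"
      by (simp add: AE_all_countable)
    then have "AE x in M. emeasure N (Pair x -` (W - D)) = 0"
    proof (rule AE_mp, intro AE_I2 impI)
      fix x assume x: "x \<in> space M" and "\<forall>q. \<not> (g x < of_rat q \<and> of_rat q < f x)"
      then have "f x \<le> g x" using of_rat_dense by (meson not_le)
      moreover have "Pair x -` W \<in> sets N" "Pair x -` D \<in> sets N"
        using x spM by (auto intro: vimage_Pair_sets Wm Dm)
      moreover have "Pair x -` D \<subseteq> Pair x -` W" using C(2) by (auto simp: D_def)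
      ultimately have "measure N (Pair x -` W - Pair x -` D) \<le> 0"
        unfolding f_def g_def by (simp add: N.finite_measure_Diff)
      then show "emeasure N (Pair x -` (W - D)) = 0"
        by (simp add: N.emeasure_eq_measure vimage_Diff measure_le_0_iff)
    qed
    then have "(\<integral>\<^sup>+x. emeasure N (Pair x -` (W - D)) \<partial>M) = 0"
      by (simp cong: nn_integral_cong_AE)
    then have "measure ?P (W - D) = 0"
      using emeasure_radon_product[of "W - D"] Wm Dm
      by (simp add: sets.Diff P.emeasure_eq_measure)
    then show "compact_inner_regular ?Z ?P W"
      using C(1,2) Wm unfolding D_def
      by (intro compact_inner_regularI_sigma_compact[OF Z P.finite_measure_axioms sP, of W C])
         (auto simp: sP)
  qed
qed

end

text \<open>A compact set approximating the preimage of \<open>A\<close> has a compact image inside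
  \<open>A\<close>, and the preimage of that image is at least as large.\<close>

lemma radon_prob_distr:
  assumes Y: "Hausdorff_space Y" and f: "continuous_map X Y f" and M: "radon_prob X M"
  shows "radon_prob Y (distr M (borel_of Y) f)"
proof -
  interpret prob_space M using M by (simp add: radon_prob_def)
  have sM: "sets M = sets (borel_of X)" using M by (simp add: radon_prob_def)
  have fm: "f \<in> M \<rightarrow>\<^sub>M borel_of Y"
    using continuous_map_measurable[OF f] measurable_cong_sets[OF sM refl] by blast
  have "compact_inner_regular Y (distr M (borel_of Y) f) A" if A: "A \<in> sets (borel_of Y)" for A
    unfolding compact_inner_regular_def
  proof (intro allI impI)
    fix e :: real assume e: "e > 0"
    have "f -` A \<inter> space M \<in> sets M" using fm A by (rule measurable_sets)
    then obtain K where K: "compactin X K" "K \<subseteq> f -` A \<inter> space M"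
        "measure M (f -` A \<inter> space M) < measure M K + e"
      using M e unfolding radon_prob_iff compact_inner_regular_def by meson
    have fK: "compactin Y (f ` K)" using image_compactin[OF K(1) f] .
    then have fKm: "f ` K \<in> sets (borel_of Y)" by (rule compactin_borel_of[OF Y])
    have "measure M K \<le> measure M (f -` (f ` K) \<inter> space M)"
      using K(2) measurable_sets[OF fm fKm] by (intro finite_measure_mono) auto
    then have "measure (distr M (borel_of Y) f) A < measure (distr M (borel_of Y) f) (f ` K) + e"
      using K(3) by (simp add: measure_distr[OF fm] A fKm)
    with fK K(2) show "\<exists>K. compactin Y K \<and> K \<subseteq> A \<and>
        measure (distr M (borel_of Y) f) A < measure (distr M (borel_of Y) f) K + e"
      by (intro exI[of _ "f ` K"]) auto
  qed
  then show ?thesis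
    unfolding radon_prob_iff using prob_space_distr[OF fm] by simp
qed

section \<open>Couplings charging given rectangles\<close>

text \<open>\<open>v\<close> spreads mass \<open>b j\<close> evenly over \<open>H j\<close>. At each
  point at most one summand is nonzero, and it is at most 1 since
  \<open>b j \<le> prob (H j)\<close>. Hence \<open>1 - v\<close> can serve as a density for the
  mass left over.\<close>

lemma (in prob_space) normalized_step_function:
  fixes b :: "'j \<Rightarrow> real"
  assumes J: "finite J" "disjoint_family_on H J" and H: "\<And>j. j \<in> J \<Longrightarrow> H j \<in> sets M"
    and b: "\<And>j. j \<in> J \<Longrightarrow> 0 \<le> b j" "\<And>j. j \<in> J \<Longrightarrow> b j \<le> prob (H j)"
  defines "v \<equiv> \<lambda>y. \<Sum>j\<in>J. b j / prob (H j) * indicator (H j) y"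
  shows "v y \<le> 1" "integrable M v" "integral\<^sup>L M v = (\<Sum>j\<in>J. b j)"
proof -
  have int: "integrable M (\<lambda>y. b j / prob (H j) * indicator (H j) y :: real)" if "j \<in> J" for j
    using H[OF that] by (simp add: emeasure_eq_measure)
  then show "integrable M v"
    unfolding v_def by (rule Bochner_Integration.integrable_sum)
  have "integral\<^sup>L M v = (\<Sum>j\<in>J. \<integral>y. b j / prob (H j) * indicator (H j) y \<partial>M)"
    unfolding v_def by (rule Bochner_Integration.integral_sum) (rule int)
  also have "\<dots> = (\<Sum>j\<in>J. b j)"
  proof (intro sum.cong refl)
    \<comment> \<open>If \<open>prob (H j) = 0\<close>, then \<open>b j = 0\<close> as well, so the
      value 0 for division by zero is the right one.\<close>
    fix j assume "j \<in> J"
    then show "(\<integral>y. b j / prob (H j) * indicator (H j) y \<partial>M) = b j"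
      using H[of j] b[of j] sets.sets_into_space[OF H[of j]] by (cases "prob (H j) = 0") (auto simp: Int_absorb2)
  qed
  finally show "integral\<^sup>L M v = (\<Sum>j\<in>J. b j)" .
  show "v y \<le> 1"
  proof (cases "\<exists>j\<in>J. y \<in> H j")
    case True
    then obtain j where j: "j \<in> J" "y \<in> H j" by blast
    have "v y = (\<Sum>k\<in>J. if k = j then b j / prob (H j) else 0)"
      unfolding v_def
    proof (intro sum.cong refl)
      fix k assume "k \<in> J"
      then have "k \<noteq> j \<Longrightarrow> y \<notin> H k" using j J(2) unfolding disjoint_family_on_def by blast
      then show "b k / prob (H k) * indicator (H k) y = (if k = j then b j / prob (H j) else 0)"
        using j by auto
    qed
    also have "\<dots> = b j / prob (H j)" using j J(1) by simp
    also have "\<dots> \<le> 1" using b[OF j(1)] by (simp add: divide_le_eq_1 less_le)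
    finally show ?thesis .
  next
    case False
    then have "v y = 0" unfolding v_def by (intro sum.neutral) auto
    then show ?thesis by simp
  qed
qed

text \<open>On each rectangle \<open>G i \<times> H j\<close> mass \<open>c i j\<close> is spread proportionally to the product
  measure; what the marginals have left is coupled independently.\<close>

definition coupling_density ::
    "'a measure \<Rightarrow> 'b measure \<Rightarrow> 'i set \<Rightarrow> 'j set \<Rightarrow> ('i \<Rightarrow> 'a set) \<Rightarrow> ('j \<Rightarrow> 'b set) \<Rightarrow>
     ('i \<Rightarrow> 'j \<Rightarrow> real) \<Rightarrow> 'a \<Rightarrow> 'b \<Rightarrow> real" where
  "coupling_density M N I J G H c x y =
     (\<Sum>i\<in>I. \<Sum>j\<in>J. c i j / (measure M (G i) * measure N (H j))
        * indicator (G i) x * indicator (H j) y)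
     + (1 - (\<Sum>i\<in>I. (\<Sum>j\<in>J. c i j) / measure M (G i) * indicator (G i) x))
       * (1 - (\<Sum>j\<in>J. (\<Sum>i\<in>I. c i j) / measure N (H j) * indicator (H j) y))
       / (1 - (\<Sum>i\<in>I. \<Sum>j\<in>J. c i j))"

text \<open>The formula is symmetric in the two factors, so one computation of a marginal serves for
  both.\<close>

lemma coupling_density_swap:
  "coupling_density N M J I H G (\<lambda>j i. c i j) y x = coupling_density M N I J G H c x y"
  unfolding coupling_density_def
  by (subst (1 4) sum.swap) (simp add: mult_ac)

text \<open>\<open>row\<close> and \<open>col\<close> say that the prescribed masses fit into the
  two marginals. \<open>total\<close> is strict because the density divides by the mass left
  over.\<close>

locale step_coupling = M: prob_space M + N: prob_space N
  for M :: "'a measure" and N :: "'b measure" +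
  fixes I :: "'i set" and J :: "'j set" and G :: "'i \<Rightarrow> 'a set" and H :: "'j \<Rightarrow> 'b set"
    and c :: "'i \<Rightarrow> 'j \<Rightarrow> real"
  assumes finI: "finite I" and finJ: "finite J"
    and disjG: "disjoint_family_on G I" and disjH: "disjoint_family_on H J"
    and Gm: "\<And>i. i \<in> I \<Longrightarrow> G i \<in> sets M" and Hm: "\<And>j. j \<in> J \<Longrightarrow> H j \<in> sets N"
    and c_nonneg: "\<And>i j. i \<in> I \<Longrightarrow> j \<in> J \<Longrightarrow> 0 \<le> c i j"
    and row: "\<And>i. i \<in> I \<Longrightarrow> (\<Sum>j\<in>J. c i j) \<le> measure M (G i)"
    and col: "\<And>j. j \<in> J \<Longrightarrow> (\<Sum>i\<in>I. c i j) \<le> measure N (H j)"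
    and total: "(\<Sum>i\<in>I. \<Sum>j\<in>J. c i j) < 1"
begin

abbreviation "h \<equiv> coupling_density M N I J G H c"

lemma swap: "step_coupling N M J I H G (\<lambda>j i. c i j)"
  using finI finJ disjG disjH Gm Hm c_nonneg row col total
  by unfold_locales (auto simp: sum.swap[of _ I J])

lemma row_nonneg: "i \<in> I \<Longrightarrow> 0 \<le> (\<Sum>j\<in>J. c i j)"
  and col_nonneg: "j \<in> J \<Longrightarrow> 0 \<le> (\<Sum>i\<in>I. c i j)"
  using c_nonneg by (auto intro: sum_nonneg)

text \<open>The step functions of the row and column sums are at most 1, so both factors of the
  independent remainder in \<open>h\<close> are nonnegative.\<close>

lemmas u = M.normalized_step_function[OF finI disjG Gm row_nonneg row, simplified]
lemmas v = N.normalized_step_function[OF finJ disjH Hm col_nonneg col, simplified]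

lemma c_le: "i \<in> I \<Longrightarrow> j \<in> J \<Longrightarrow> c i j \<le> measure M (G i)"
  "i \<in> I \<Longrightarrow> j \<in> J \<Longrightarrow> c i j \<le> measure N (H j)"
  using member_le_sum[of j J "c i"] member_le_sum[of i I "\<lambda>i. c i j"] row[of i] col[of j]
    finI finJ c_nonneg by fastforce+

text \<open>This justifies cancelling in \<open>c i j / (measure M (G i) * measure N (H j))\<close>
  even when a factor of the denominator vanishes.\<close>

lemma c_eq_0: 
  assumes "i \<in> I" "j \<in> J" "measure M (G i) = 0 \<or> measure N (H j) = 0" 
  shows "c i j = 0"
  using c_le[of i j] c_nonneg[of i j] assms by auto

text \<open>All summands of \<open>h\<close> are nonnegative, so any single rectangle term is a
  lower bound. This yields the prescribed mass on \<open>G i \<times> H j\<close>.\<close>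

lemma density_ge:
  assumes "i \<in> I" "j \<in> J"
  shows "c i j / (measure M (G i) * measure N (H j)) * indicator (G i) x * indicator (H j) y \<le> h x y"
    (is "?t i j \<le> _")
proof -
  have nn: "0 \<le> ?t i j" if "i \<in> I" "j \<in> J" for i j
    using c_nonneg[OF that] by simp
  have "?t i j \<le> (\<Sum>j\<in>J. ?t i j)"
    using assms nn finJ by (intro member_le_sum) auto
  also have "\<dots> \<le> (\<Sum>i\<in>I. \<Sum>j\<in>J. ?t i j)"
    using assms nn finI by (intro member_le_sum[of i I "\<lambda>i. \<Sum>j\<in>J. ?t i j"] sum_nonneg) auto
  also have "\<dots> \<le> h x y"
    unfolding coupling_density_def
    using u(1)[of x] v(1)[of y] total by simp
  finally show ?thesis .
qed

lemma density_nonneg: "0 \<le> h x y"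
  unfolding coupling_density_def using u(1)[of x] v(1)[of y] total c_nonneg
  by (intro add_nonneg_nonneg sum_nonneg mult_nonneg_nonneg divide_nonneg_nonneg) auto

lemma density_measurable [measurable]:
  assumes [measurable]: "p \<in> Q \<rightarrow>\<^sub>M M" "q \<in> Q \<rightarrow>\<^sub>M N"
  shows "(\<lambda>z. h (p z) (q z)) \<in> borel_measurable Q"
proof -
  note [measurable] = Gm Hm
  show ?thesis unfolding coupling_density_def by measurable
qed

text \<open>Integrating out \<open>y\<close>, the rectangle terms leave the row step function at
  \<open>x\<close>. The factor \<open>?g\<close> of the remainder integrates to \<open>?r\<close>,
  which cancels the denominator and leaves \<open>?f\<close>, exactly the complement to 1.\<close>

lemma nn_integral_density: "(\<integral>\<^sup>+y. h x y \<partial>N) = 1"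
proof -
  let ?t = "\<lambda>i j. c i j / (measure M (G i) * measure N (H j)) * indicator (G i) x"
  let ?f = "1 - (\<Sum>i\<in>I. (\<Sum>j\<in>J. c i j) / measure M (G i) * indicator (G i) x)"
  let ?g = "\<lambda>y. 1 - (\<Sum>j\<in>J. (\<Sum>i\<in>I. c i j) / measure N (H j) * indicator (H j) y)"
  let ?r = "1 - (\<Sum>i\<in>I. \<Sum>j\<in>J. c i j)"
  have intH: "integrable N (\<lambda>y. ?t i j * indicator (H j) y)" if "j \<in> J" for i j
    using Hm[OF that] by (simp add: N.emeasure_eq_measure)
  have intg: "integrable N ?g" using v(2) by simp
  have g: "(\<integral>y. ?g y \<partial>N) = ?r"
    using v(2,3) by (simp add: N.prob_space sum.swap[of _ I J])
  have "(\<integral>y. h x y \<partial>N) = (\<Sum>i\<in>I. \<Sum>j\<in>J. ?t i j * measure N (H j)) + ?f * ?r / ?r"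
    unfolding coupling_density_def using intH intg g
    by (subst Bochner_Integration.integral_add)
       (auto simp: Bochner_Integration.integral_sum Bochner_Integration.integrable_sum Int_absorb2
          sets.sets_into_space[OF Hm])
  also have "(\<Sum>i\<in>I. \<Sum>j\<in>J. ?t i j * measure N (H j))
      = (\<Sum>i\<in>I. \<Sum>j\<in>J. c i j / measure M (G i) * indicator (G i) x)"
    using c_eq_0 by (intro sum.cong refl) auto
  also have "\<dots> = 1 - ?f"
    by (simp add: sum_divide_distrib sum_distrib_right)
  finally have "(\<integral>y. h x y \<partial>N) = 1" using total by simp
  moreover have "integrable N (h x)"
    unfolding coupling_density_def using intH intg by (intro Bochner_Integration.integrable_add Bochner_Integration.integrable_sum) auto
  ultimately show ?thesis
    using density_nonneg by (subst nn_integral_eq_integral) auto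
qed

end

text \<open>\<open>L\<close> has density \<open>h\<close> with respect to the Radon product:
  absolute continuity makes it Radon, integrating out one variable gives the marginals, and
  \<open>density_ge\<close> gives the masses of the rectangles.\<close>

lemma radon_coupling_with_rectangles:
  fixes X :: "'a topology" and Y :: "'b topology"
  assumes X: "Hausdorff_space X" and Y: "Hausdorff_space Y"
    and M: "radon_prob X M" and N: "radon_prob Y N"
    and sc: "step_coupling M N I J G H c"
  obtains L where "radon_prob (prod_topology X Y) L"
    "distr L (borel_of X) fst = M" "distr L (borel_of Y) snd = N"
    "\<forall>i\<in>I. \<forall>j\<in>J. c i j \<le> measure L (G i \<times> H j)"
proof -
  interpret step_coupling M N I J G H c by fact
  interpret S: step_coupling N M J I H G "\<lambda>j i. c i j" by (rule swap)
  interpret MN: pair_sigma_finite M N ..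
  let ?Z = "prod_topology X Y"
  let ?P = "radon_product X Y M N"
  have Z: "Hausdorff_space ?Z" using X Y by (simp add: Hausdorff_space_prod_topology)
  have sM [measurable_cong]: "sets M = sets (borel_of X)"
    and sN [measurable_cong]: "sets N = sets (borel_of Y)"
    using M N by (auto simp: radon_prob_def)
  note spM = radon_prob_space[OF M] and spN = radon_prob_space[OF N]
  have fst [measurable]: "fst \<in> borel_of ?Z \<rightarrow>\<^sub>M borel_of X"
    and snd [measurable]: "snd \<in> borel_of ?Z \<rightarrow>\<^sub>M borel_of Y"
    by (intro continuous_map_measurable continuous_map_fst continuous_map_snd)+
  define L where "L = density ?P (\<lambda>z. ennreal (h (fst z) (snd z)))"
  have "fst \<in> ?P \<rightarrow>\<^sub>M M" "snd \<in> ?P \<rightarrow>\<^sub>M N"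
    using fst snd measurable_cong_sets[OF sets_radon_product[OF M N] sM]
      measurable_cong_sets[OF sets_radon_product[OF M N] sN] by auto
  then have "(\<lambda>z. h (fst z) (snd z)) \<in> borel_measurable ?P"
    by (rule density_measurable)
  then have hm: "(\<lambda>z. ennreal (h (fst z) (snd z))) \<in> borel_measurable ?P"
    by simp
  have sL [measurable_cong]: "sets L = sets (borel_of ?Z)"
    by (simp add: L_def sets_radon_product[OF M N])
  then have spL: "space L = topspace X \<times> topspace Y"
    using sets_eq_imp_space_eq[OF sL] by (simp add: space_borel_of)
  have fL: "fst \<in> L \<rightarrow>\<^sub>M borel_of X" and sndL: "snd \<in> L \<rightarrow>\<^sub>M borel_of Y" by measurable
  have rect: "A \<times> B \<in> sets (borel_of ?Z)" if "A \<in> sets M" "B \<in> sets N" for A B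
  proof -
    have "A \<times> B = (fst -` A \<inter> space (borel_of ?Z)) \<inter> (snd -` B \<inter> space (borel_of ?Z))"
      using sets.sets_into_space[OF that(1)] sets.sets_into_space[OF that(2)]
      by (auto simp: space_borel_of spM spN)
    also have "\<dots> \<in> sets (borel_of ?Z)"
      using that sM sN by (intro sets.Int measurable_sets[OF fst] measurable_sets[OF snd]) auto
    finally show ?thesis .
  qed
  have em: "emeasure L (A \<times> B) = (\<integral>\<^sup>+x. \<integral>\<^sup>+y. ennreal (h x y) * indicator A x * indicator B y \<partial>N \<partial>M)"
    if A: "A \<in> sets M" and B: "B \<in> sets N" for A B
  proof -
    have "emeasure L (A \<times> B) = (\<integral>\<^sup>+z. ennreal (h (fst z) (snd z)) * indicator (A \<times> B) z \<partial>?P)"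
      unfolding L_def using hm rect[OF A B] sets_radon_product[OF M N]
      by (intro emeasure_density) auto
    also have "\<dots> = (\<integral>\<^sup>+x. \<integral>\<^sup>+y. ennreal (h (fst (x,y)) (snd (x,y))) * indicator (A \<times> B) (x,y) \<partial>N \<partial>M)"
      using hm measurable_cong_sets[OF sets_radon_product[OF M N] refl]
      by (intro nn_integral_radon_product[OF M N] borel_measurable_times_ennreal
          borel_measurable_indicator[OF rect[OF A B]]) blast
    finally show ?thesis
      by (simp add: indicator_times mult.assoc)
  qed
  have fst_marginal: "emeasure L (A \<times> topspace Y) = emeasure M A" if A: "A \<in> sets M" for A
  proof -
    have "topspace Y \<in> sets N" using spN by (metis sets.top)
    then have "emeasure L (A \<times> topspace Y)
        = (\<integral>\<^sup>+x. \<integral>\<^sup>+y. ennreal (h x y) * indicator A x * indicator (topspace Y) y \<partial>N \<partial>M)"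
      by (rule em[OF A])
    also have "\<dots> = (\<integral>\<^sup>+x. \<integral>\<^sup>+y. ennreal (h x y) * indicator A x \<partial>N \<partial>M)"
      by (intro nn_integral_cong) (simp add: spN)
    also have "\<dots> = (\<integral>\<^sup>+x. (\<integral>\<^sup>+y. ennreal (h x y) \<partial>N) * indicator A x \<partial>M)"
      by (intro nn_integral_cong nn_integral_multc) measurable
    finally show ?thesis using A by (simp add: nn_integral_density)
  qed
  have snd_marginal: "emeasure L (topspace X \<times> B) = emeasure N B" if B: "B \<in> sets N" for B
  proof -
    note [measurable] = B
    have "topspace X \<in> sets M" using spM by (metis sets.top)
    then have "emeasure L (topspace X \<times> B)
        = (\<integral>\<^sup>+x. \<integral>\<^sup>+y. ennreal (h x y) * indicator (topspace X) x * indicator B y \<partial>N \<partial>M)"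
      by (rule em[OF _ B])
    also have "\<dots> = (\<integral>\<^sup>+x. \<integral>\<^sup>+y. ennreal (h x y) * indicator B y \<partial>N \<partial>M)"
      by (intro nn_integral_cong) (simp add: spM)
    \<comment> \<open>The integrand is measurable already for the product sigma-algebra, so the
      ordinary Fubini theorem for \<open>M\<close> and \<open>N\<close> applies.\<close>
    also have "\<dots> = (\<integral>\<^sup>+y. \<integral>\<^sup>+x. ennreal (h x y) * indicator B y \<partial>M \<partial>N)"
      by (rule MN.Fubini'[symmetric]) measurable
    also have "\<dots> = (\<integral>\<^sup>+y. (\<integral>\<^sup>+x. ennreal (h x y) \<partial>M) * indicator B y \<partial>N)"
      by (intro nn_integral_cong nn_integral_multc) measurable
    finally show ?thesis
      using B S.nn_integral_density by (simp add: coupling_density_swap[of N M J I H G c])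
  qed
  have prob: "prob_space L"
  proof
    show "emeasure L (space L) = 1"
      using fst_marginal[of "topspace X"] M.emeasure_space_1 sets.top[of M] by (simp add: spL spM)
  qed
  show thesis
  proof (rule that; (intro ballI)?)
    show "radon_prob ?Z L"
    proof (rule radon_prob_absolutely_continuous[OF Z radon_prob_radon_product[OF M N X Y] prob])
      show "sets L = sets ?P" by (simp add: sL sets_radon_product[OF M N])
      show "absolutely_continuous ?P L"
        unfolding L_def using hm by (rule absolutely_continuousI_density)
    qed
    show "distr L (borel_of X) fst = M"
    proof (rule measure_eqI)
      fix A assume "A \<in> sets (distr L (borel_of X) fst)"
      then have A: "A \<in> sets M" by (simp add: sM)
      have "fst -` A \<inter> space L = A \<times> topspace Y"
        using sets.sets_into_space[OF A] by (auto simp: spL spM)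
      then show "emeasure (distr L (borel_of X) fst) A = emeasure M A"
        using fL A fst_marginal[OF A] by (simp add: emeasure_distr sM)
    qed (simp add: sM)
    show "distr L (borel_of Y) snd = N"
    proof (rule measure_eqI)
      fix B assume "B \<in> sets (distr L (borel_of Y) snd)"
      then have B: "B \<in> sets N" by (simp add: sN)
      have "snd -` B \<inter> space L = topspace X \<times> B"
        using sets.sets_into_space[OF B] by (auto simp: spL spN)
      then show "emeasure (distr L (borel_of Y) snd) B = emeasure N B"
        using sndL B snd_marginal[OF B] by (simp add: emeasure_distr sN)
    qed (simp add: sN)
    fix i j assume ij: "i \<in> I" "j \<in> J"
    interpret L: prob_space L by fact
    \<comment> \<open>\<open>?k\<close> is the constant height of the rectangle term of
      \<open>h\<close>; it integrates to \<open>c i j\<close>, also when a side is null, by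
      \<open>c_eq_0\<close>.\<close>
    let ?k = "c i j / (measure M (G i) * measure N (H j))"
    have k: "0 \<le> ?k" using c_nonneg[OF ij] by simp
    have "c i j = ?k * measure M (G i) * measure N (H j)"
      using c_eq_0[OF ij] by auto
    then have "ennreal (c i j) = ennreal ?k * ennreal (measure M (G i)) * ennreal (measure N (H j))"
      using k by (metis ennreal_mult measure_nonneg mult_nonneg_nonneg)
    also have "\<dots> = (\<integral>\<^sup>+x. \<integral>\<^sup>+y. ennreal ?k * indicator (G i) x * indicator (H j) y \<partial>N \<partial>M)"
      using Gm[OF ij(1)] Hm[OF ij(2)]
      by (simp add: nn_integral_cmult nn_integral_multc M.emeasure_eq_measure N.emeasure_eq_measure)
    also have "\<dots> \<le> (\<integral>\<^sup>+x. \<integral>\<^sup>+y. ennreal (h x y) * indicator (G i) x * indicator (H j) y \<partial>N \<partial>M)"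
    proof (intro nn_integral_mono)
      fix x y
      show "ennreal ?k * indicator (G i) x * indicator (H j) y
          \<le> ennreal (h x y) * indicator (G i) x * indicator (H j) y"
        using density_ge[OF ij, of x y]
        by (cases "x \<in> G i"; cases "y \<in> H j") (auto intro: ennreal_leI)
    qed
    also have "\<dots> = emeasure L (G i \<times> H j)"
      using em[OF Gm[OF ij(1)] Hm[OF ij(2)]] by simp
    finally show "c i j \<le> measure L (G i \<times> H j)"
      by (simp add: L.emeasure_eq_measure)
  qed
qed

section \<open>Lifting nearby marginals\<close>

text \<open>By induction: the new compact set is separated from the compact union of the earlier
  ones, and the earlier neighbourhoods are shrunk accordingly.\<close>

lemma Hausdorff_space_finite_compact_separation:
  assumes X: "Hausdorff_space X" and "finite I" "disjoint_family_on K I"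
    and "\<And>i. i \<in> I \<Longrightarrow> compactin X (K i)"
  shows "\<exists>G. (\<forall>i\<in>I. openin X (G i) \<and> K i \<subseteq> G i) \<and> disjoint_family_on G I"
  using assms(2-)
proof (induction I)
  case empty
  then show ?case by (simp add: disjoint_family_on_def)
next
  case (insert i I)
  then have "disjoint_family_on K I" by (auto simp: disjoint_family_on_def)
  with insert obtain G where G: "\<And>j. j \<in> I \<Longrightarrow> openin X (G j) \<and> K j \<subseteq> G j"
      "disjoint_family_on G I" by auto
  have "compactin X (\<Union>j\<in>I. K j)"
    using insert by (intro compactin_Union) auto
  moreover have "disjnt (K i) (\<Union>j\<in>I. K j)"
    using insert.hyps(2) insert.prems(1) by (fastforce simp: disjoint_family_on_def disjnt_def)
  ultimately obtain U V where UV: "openin X U" "openin X V" "K i \<subseteq> U" "(\<Union>j\<in>I. K j) \<subseteq> V" "disjnt U V"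
    using Hausdorff_space_compact_separation[OF X] insert.prems(2)[of i] by blast
  define G' where "G' j = (if j = i then U else G j \<inter> V)" for j
  have "\<forall>j\<in>insert i I. openin X (G' j) \<and> K j \<subseteq> G' j"
    using G(1) UV by (auto simp: G'_def)
  moreover have "disjoint_family_on G' (insert i I)"
    using G(2) UV(5) insert.hyps(2) unfolding disjoint_family_on_def G'_def disjnt_def
    by (auto split: if_splits)
  ultimately show ?case by blast
qed

text \<open>The compact sets approximate the atoms of the Boolean algebra generated by \<open>\<U>\<close>; an atom is
  indexed by the set of members of \<open>\<U>\<close> that contain it.\<close>

lemma radon_compact_partition:
  assumes X: "Hausdorff_space X" and M: "radon_prob X M"
    and \<U>: "finite \<U>" "\<And>U. U \<in> \<U> \<Longrightarrow> openin X U" and \<eta>: "0 < \<eta>"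
  obtains K G :: "'a set set \<Rightarrow> 'a set" where
    "\<forall>p\<in>Pow \<U>. compactin X (K p) \<and> openin X (G p) \<and> K p \<subseteq> G p"
    "\<forall>p\<in>Pow \<U>. \<forall>U\<in>\<U>. K p \<inter> U \<noteq> {} \<longrightarrow> G p \<subseteq> U"
    "disjoint_family_on G (Pow \<U>)"
    "measure M (topspace X - (\<Union>p\<in>Pow \<U>. K p)) < \<eta>"
proof -
  interpret prob_space M using M by (simp add: radon_prob_def)
  have sM: "sets M = sets (borel_of X)" using M by (simp add: radon_prob_def)
  note spM = radon_prob_space[OF M]
  define A where "A p = {x \<in> space M. \<forall>U\<in>\<U>. x \<in> U \<longleftrightarrow> U \<in> p}" for p
  have Am: "A p \<in> sets M" for p
  proof -
    have "{x \<in> space M. x \<in> U \<longleftrightarrow> U \<in> p} \<in> sets M" if "U \<in> \<U>" for U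
    proof -
      have Um: "U \<in> sets M" using openin_borel_of[OF \<U>(2)[OF that]] sM by simp
      have "{x \<in> space M. x \<in> U \<longleftrightarrow> U \<in> p} = (if U \<in> p then U else space M - U)"
        using sets.sets_into_space[OF Um] by auto
      then show ?thesis using Um by auto
    qed
    then show ?thesis unfolding A_def using \<U>(1) by (rule sets.sets_Collect_finite_All)
  qed
  \<comment> \<open>There are at most \<open>n\<close> nonempty atoms. A loss of
    \<open>\<eta> / (2 * n)\<close> on each adds up to \<open>\<eta> / 2\<close>, which makes the
    final bound strict.\<close>
  define n where "n = real (card (Pow \<U>))"
  have n: "n > 0" using \<U>(1) by (simp add: n_def card_Pow)
  have "\<exists>K. compactin X K \<and> K \<subseteq> A p \<and> measure M (A p) < measure M K + \<eta> / (2 * n)" for p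
    using M Am[of p] \<eta> n unfolding radon_prob_iff compact_inner_regular_def
    by (metis divide_pos_pos mult_pos_pos zero_less_numeral)
  then obtain K where K: "\<And>p. compactin X (K p)" "\<And>p. K p \<subseteq> A p"
      "\<And>p. measure M (A p) < measure M (K p) + \<eta> / (2 * n)" by metis
  have Km: "K p \<in> sets M" for p using compactin_borel_of[OF X K(1)] sM by simp
  have disjA: "p = p'" if "x \<in> A p" "x \<in> A p'" "p \<in> Pow \<U>" "p' \<in> Pow \<U>" for x p p'
    using that unfolding A_def by blast
  have "disjoint_family_on K (Pow \<U>)"
    unfolding disjoint_family_on_def using K(2) disjA by blast
  then obtain G where G: "\<And>p. p \<in> Pow \<U> \<Longrightarrow> openin X (G p) \<and> K p \<subseteq> G p"
      "disjoint_family_on G (Pow \<U>)"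
    using Hausdorff_space_finite_compact_separation[OF X, of "Pow \<U>" K] \<U>(1) K(1)
    by (metis finite_Pow_iff)
  show thesis
  \<comment> \<open>Since \<open>K p\<close> lies in the atom of \<open>p\<close>, it is contained
    in the members of \<open>p\<close> and meets no other member of \<open>\<U>\<close>.
    Intersecting with \<open>\<Inter>p\<close> therefore keeps \<open>K p\<close> and puts the
    neighbourhood inside every member that \<open>K p\<close> meets; for \<open>p = {}\<close>
    nothing is cut off.\<close>
  proof (rule that[of K "\<lambda>p. G p \<inter> \<Inter>p"]; (intro ballI conjI impI)?)
    fix p assume p: "p \<in> Pow \<U>"
    show "compactin X (K p)" by (rule K)
    show "openin X (G p \<inter> \<Inter>p)"
      using p G(1)[OF p] \<U> finite_subset[of p \<U>] by (intro openin_Int_Inter) auto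
    show "K p \<subseteq> G p \<inter> \<Inter>p"
      using G(1)[OF p] K(2)[of p] p unfolding A_def by fastforce
    fix U assume "U \<in> \<U>" "K p \<inter> U \<noteq> {}"
    then show "G p \<inter> \<Inter>p \<subseteq> U"
      using K(2)[of p] unfolding A_def by blast
  next
    show "disjoint_family_on (\<lambda>p. G p \<inter> \<Inter>p) (Pow \<U>)"
      using G(2) unfolding disjoint_family_on_def by blast
    have "measure M (topspace X - (\<Union>p\<in>Pow \<U>. K p)) \<le> measure M (\<Union>p\<in>Pow \<U>. A p - K p)"
    proof (rule finite_measure_mono)
      show "topspace X - (\<Union>p\<in>Pow \<U>. K p) \<subseteq> (\<Union>p\<in>Pow \<U>. A p - K p)"
      proof
        fix x assume x: "x \<in> topspace X - (\<Union>p\<in>Pow \<U>. K p)"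
        let ?p = "{U \<in> \<U>. x \<in> U}"
        have "?p \<in> Pow \<U>" "x \<in> A ?p" using x by (auto simp: A_def spM)
        then show "x \<in> (\<Union>p\<in>Pow \<U>. A p - K p)" using x by blast
      qed
      show "(\<Union>p\<in>Pow \<U>. A p - K p) \<in> sets M"
        using \<U>(1) Am Km by (intro sets.finite_UN) auto
    qed
    also have "\<dots> \<le> (\<Sum>p\<in>Pow \<U>. measure M (A p - K p))"
      using \<U>(1) Am Km by (intro finite_measure_subadditive_finite) auto
    also have "\<dots> \<le> (\<Sum>p\<in>Pow \<U>. \<eta> / (2 * n))"
    proof (rule sum_mono)
      fix p
      show "measure M (A p - K p) \<le> \<eta> / (2 * n)"
        using finite_measure_Diff[OF Am Km K(2), of p] K(3)[of p] by linarith
    qed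
    also have "\<dots> < \<eta>"
      using n \<eta> by (simp flip: n_def)
    finally show "measure M (topspace X - (\<Union>p\<in>Pow \<U>. K p)) < \<eta>" .
  qed
qed

text \<open>Open rectangles inside \<open>W\<close> cover it, and compactness selects finitely many.
  Their sides are the open sets that the partitions of \<open>X\<close> and \<open>Y\<close> have to
  respect.\<close>

lemma compactin_subset_open_rectangles:
  assumes W: "openin (prod_topology X Y) W" and C: "compactin (prod_topology X Y) C" "C \<subseteq> W"
  obtains R where "finite R" "\<And>U V. (U, V) \<in> R \<Longrightarrow> openin X U \<and> openin Y V \<and> U \<times> V \<subseteq> W"
    "C \<subseteq> (\<Union>(U, V)\<in>R. U \<times> V)"
proof -
  define \<R> where "\<R> = {(U, V). openin X U \<and> openin Y V \<and> U \<times> V \<subseteq> W}"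
  let ?rect = "\<lambda>(U, V). U \<times> V"
  have "C \<subseteq> \<Union>(?rect ` \<R>)"
  proof
    fix z assume "z \<in> C"
    then obtain x y where z: "z = (x, y)" "(x, y) \<in> W" using C(2) by (cases z) auto
    then obtain U V where "openin X U" "openin Y V" "x \<in> U" "y \<in> V" "U \<times> V \<subseteq> W"
      using W unfolding openin_prod_topology_alt by meson
    then show "z \<in> \<Union>(?rect ` \<R>)"
      using z by (intro UnionI[of "U \<times> V"] image_eqI[of _ _ "(U, V)"]) (auto simp: \<R>_def)
  qed
  moreover have "openin (prod_topology X Y) B" if "B \<in> ?rect ` \<R>" for B
    using that by (auto simp: \<R>_def openin_prod_Times_iff)
  ultimately have "\<exists>\<F>. finite \<F> \<and> \<F> \<subseteq> ?rect ` \<R> \<and> C \<subseteq> \<Union>\<F>"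
    by (intro compactinD[OF C(1)])
  then obtain \<F> where \<F>: "finite \<F>" "\<F> \<subseteq> ?rect ` \<R>" "C \<subseteq> \<Union>\<F>"
    by blast
  then obtain R where R: "R \<subseteq> \<R>" "finite R" "\<F> = ?rect ` R"
    using finite_subset_image[OF \<F>(1,2)] by blast
  with \<F>(3) show thesis
    by (intro that[of R]) (auto simp: \<R>_def)
qed

text \<open>If some term exceeds \<open>d\<close>, its truncation alone accounts for the full loss
  \<open>d\<close>; otherwise everything vanishes. Truncating all masses in a row thus makes room
  for a drop of \<open>d\<close> in its marginal.\<close>

lemma sum_truncated_le:
  fixes x :: "'i \<Rightarrow> real"
  assumes "finite I" and x: "\<And>i. i \<in> I \<Longrightarrow> 0 \<le> x i" and d: "0 \<le> d"
  shows "(\<Sum>i\<in>I. max 0 (x i - d)) \<le> max 0 ((\<Sum>i\<in>I. x i) - d)"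
proof (cases "\<exists>k\<in>I. d < x k")
  case True
  then obtain k where k: "k \<in> I" "d < x k" by blast
  have "(\<Sum>i\<in>I. max 0 (x i - d)) = (x k - d) + (\<Sum>i\<in>I - {k}. max 0 (x i - d))"
    using k assms(1) by (simp add: sum.remove)
  also have "(\<Sum>i\<in>I - {k}. max 0 (x i - d)) \<le> (\<Sum>i\<in>I - {k}. x i)"
    using x d by (intro sum_mono) auto
  also have "(x k - d) + \<dots> = (\<Sum>i\<in>I. x i) - d"
    using k assms(1) by (simp add: sum.remove)
  finally show ?thesis by simp
next
  case False
  then have "(\<Sum>i\<in>I. max 0 (x i - d)) = 0" by (intro sum.neutral) auto
  then show ?thesis by simp
qed

section \<open>Disjoint rectangles and the lifting of marginals\<close>

lemma disjoint_family_on_subfamily: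
  assumes "disjoint_family_on G I" "\<And>i. i \<in> I \<Longrightarrow> K i \<subseteq> G i"
  shows "disjoint_family_on K I"
  unfolding disjoint_family_on_def
proof (intro ballI impI)
  fix i j assume "i \<in> I" "j \<in> I" "i \<noteq> j"
  then show "K i \<inter> K j = {}"
    using disjoint_family_onD[OF assms(1), of i j] assms(2)[of i] assms(2)[of j] by blast
qed

lemma disjoint_family_on_Times:
  assumes "disjoint_family_on G I" "disjoint_family_on H J"
  shows "disjoint_family_on (\<lambda>(i, j). G i \<times> H j) (I \<times> J)"
  unfolding disjoint_family_on_def
proof (intro ballI impI)
  fix z z' assume "z \<in> I \<times> J" "z' \<in> I \<times> J" "z \<noteq> z'"
  then have "G (fst z) \<inter> G (fst z') = {} \<or> H (snd z) \<inter> H (snd z') = {}"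
    using disjoint_family_onD[OF assms(1), of "fst z" "fst z'"]
      disjoint_family_onD[OF assms(2), of "snd z" "snd z'"] by (auto simp: prod_eq_iff)
  then show "(case z of (i, j) \<Rightarrow> G i \<times> H j) \<inter> (case z' of (i, j) \<Rightarrow> G i \<times> H j) = {}"
    by (auto simp: case_prod_unfold)
qed

text \<open>Openness at the point \<open>L\<close>: the sides of the open rectangles determine
  neighbourhoods of the marginals, and every pair of measures in them has a coupling close to
  \<open>L\<close>.\<close>

lemma marginals_lift_nearby:
  fixes X :: "'a topology" and Y :: "'b topology"
  assumes X: "Hausdorff_space X" and Y: "Hausdorff_space Y"
    and L: "radon_prob (prod_topology X Y) L"
    and Ws: "\<And>W. W \<in> set Ws \<Longrightarrow> openin (prod_topology X Y) W" and \<epsilon>: "0 < \<epsilon>"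
  obtains Gs Hs \<delta> where "\<And>G. G \<in> set Gs \<Longrightarrow> openin X G" "\<And>H. H \<in> set Hs \<Longrightarrow> openin Y H" "0 < \<delta>"
    "\<And>M' N'. M' \<in> weak_star_basic X (distr L (borel_of X) fst) Gs \<delta> \<Longrightarrow>
       N' \<in> weak_star_basic Y (distr L (borel_of Y) snd) Hs \<delta> \<Longrightarrow>
       \<exists>L' \<in> weak_star_basic (prod_topology X Y) L Ws \<epsilon>. marginals X Y L' = (M', N')"
proof -
  let ?Z = "prod_topology X Y"
  define M where "M = distr L (borel_of X) fst"
  define N where "N = distr L (borel_of Y) snd"
  have Z: "Hausdorff_space ?Z" using X Y by (simp add: Hausdorff_space_prod_topology)
  interpret L: prob_space L using L by (simp add: radon_prob_def)
  have sL: "sets L = sets (borel_of ?Z)" using L by (simp add: radon_prob_def)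
  have spL: "space L = topspace X \<times> topspace Y" using radon_prob_space[OF L] by simp
  have M: "radon_prob X M" and N: "radon_prob Y N"
    unfolding M_def N_def using X Y L
    by (auto intro: radon_prob_distr[OF _ continuous_map_fst] radon_prob_distr[OF _ continuous_map_snd])
  have fst: "fst \<in> L \<rightarrow>\<^sub>M borel_of X" and snd: "snd \<in> L \<rightarrow>\<^sub>M borel_of Y"
    using continuous_map_measurable[OF continuous_map_fst, of X Y]
      continuous_map_measurable[OF continuous_map_snd, of X Y]
      measurable_cong_sets[OF sL refl] by blast+
  have MA: "measure M A = measure L (A \<times> topspace Y)" and AmL: "A \<times> topspace Y \<in> sets L"
    if "A \<in> sets (borel_of X)" for A
  proof -
    have "fst -` A \<inter> space L = A \<times> topspace Y"
      using sets.sets_into_space[OF that] by (auto simp: spL space_borel_of)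
    then show "measure M A = measure L (A \<times> topspace Y)" "A \<times> topspace Y \<in> sets L"
      using fst that measurable_sets[OF fst that] by (auto simp: M_def measure_distr)
  qed
  have NB: "measure N B = measure L (topspace X \<times> B)" and BmL: "topspace X \<times> B \<in> sets L"
    if "B \<in> sets (borel_of Y)" for B
  proof -
    have "snd -` B \<inter> space L = topspace X \<times> B"
      using sets.sets_into_space[OF that] by (auto simp: spL space_borel_of)
    then show "measure N B = measure L (topspace X \<times> B)" "topspace X \<times> B \<in> sets L"
      using snd that measurable_sets[OF snd that] by (auto simp: N_def measure_distr)
  qed

  \<comment> \<open>Error budget: \<open>\<epsilon> / 3\<close> for the compact approximation of
    \<open>W\<close>, \<open>\<epsilon> / 6\<close> for the loss in each factor outside the compact
    partition sets, and \<open>\<epsilon> / 3\<close> for truncation.\<close>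
  have "\<exists>C. compactin ?Z C \<and> C \<subseteq> W \<and> measure L W < measure L C + \<epsilon> / 3" if "W \<in> set Ws" for W
    using L openin_borel_of[OF Ws[OF that]] sL \<epsilon> unfolding radon_prob_iff compact_inner_regular_def
    by (metis divide_pos_pos zero_less_numeral)
  then obtain C where C: "\<And>W. W \<in> set Ws \<Longrightarrow> compactin ?Z (C W)" "\<And>W. W \<in> set Ws \<Longrightarrow> C W \<subseteq> W"
      "\<And>W. W \<in> set Ws \<Longrightarrow> measure L W < measure L (C W) + \<epsilon> / 3"
    by metis
  have "\<forall>W\<in>set Ws. \<exists>R. finite R \<and> (\<forall>(U, V)\<in>R. openin X U \<and> openin Y V \<and> U \<times> V \<subseteq> W) \<and>
      C W \<subseteq> (\<Union>(U, V)\<in>R. U \<times> V)"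
  proof
    fix W assume W: "W \<in> set Ws"
    obtain R where "finite R" "\<And>U V. (U, V) \<in> R \<Longrightarrow> openin X U \<and> openin Y V \<and> U \<times> V \<subseteq> W"
        "C W \<subseteq> (\<Union>(U, V)\<in>R. U \<times> V)"
      by (rule compactin_subset_open_rectangles[OF Ws[OF W] C(1)[OF W] C(2)[OF W]]) blast
    then show "\<exists>R. finite R \<and> (\<forall>(U, V)\<in>R. openin X U \<and> openin Y V \<and> U \<times> V \<subseteq> W) \<and>
        C W \<subseteq> (\<Union>(U, V)\<in>R. U \<times> V)"
      by (intro exI[of _ R]) auto
  qed
  from bchoice[OF this] obtain R where R: "\<forall>W\<in>set Ws. finite (R W) \<and>
      (\<forall>(U, V)\<in>R W. openin X U \<and> openin Y V \<and> U \<times> V \<subseteq> W) \<and>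
      C W \<subseteq> (\<Union>(U, V)\<in>R W. U \<times> V)" ..
  define \<U> where "\<U> = (\<Union>W\<in>set Ws. fst ` R W)"
  define \<V> where "\<V> = (\<Union>W\<in>set Ws. snd ` R W)"
  have \<U>: "finite \<U>" "\<And>U. U \<in> \<U> \<Longrightarrow> openin X U" and \<V>: "finite \<V>" "\<And>V. V \<in> \<V> \<Longrightarrow> openin Y V"
    using R by (fastforce simp: \<U>_def \<V>_def)+
  have \<epsilon>6: "0 < \<epsilon> / 6" using \<epsilon> by simp
  obtain K G :: "'a set set \<Rightarrow> 'a set" where
    KG: "\<forall>p\<in>Pow \<U>. compactin X (K p) \<and> openin X (G p) \<and> K p \<subseteq> G p"
    and GU: "\<forall>p\<in>Pow \<U>. \<forall>U\<in>\<U>. K p \<inter> U \<noteq> {} \<longrightarrow> G p \<subseteq> U"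
    and disjG: "disjoint_family_on G (Pow \<U>)"
    and lossX: "measure M (topspace X - (\<Union>p\<in>Pow \<U>. K p)) < \<epsilon> / 6"
    by (rule radon_compact_partition[OF X M \<U> \<epsilon>6]) blast+
  obtain K' H :: "'b set set \<Rightarrow> 'b set" where
    KH: "\<forall>q\<in>Pow \<V>. compactin Y (K' q) \<and> openin Y (H q) \<and> K' q \<subseteq> H q"
    and HV: "\<forall>q\<in>Pow \<V>. \<forall>V\<in>\<V>. K' q \<inter> V \<noteq> {} \<longrightarrow> H q \<subseteq> V"
    and disjH: "disjoint_family_on H (Pow \<V>)"
    and lossY: "measure N (topspace Y - (\<Union>q\<in>Pow \<V>. K' q)) < \<epsilon> / 6"
    by (rule radon_compact_partition[OF Y N \<V> \<epsilon>6]) blast+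
  have K: "compactin X (K p)" and G: "openin X (G p)" and KG: "K p \<subseteq> G p"
    if "p \<in> Pow \<U>" for p using that KG by blast+
  have K': "compactin Y (K' q)" and H: "openin Y (H q)" and KH: "K' q \<subseteq> H q"
    if "q \<in> Pow \<V>" for q using that KH by blast+
  let ?I = "Pow \<U>" and ?J = "Pow \<V>"
  have fin: "finite ?I" "finite ?J" using \<U> \<V> by auto
  define d where "d p q = measure L (K p \<times> K' q)" for p q
  \<comment> \<open>Decreasing each of the \<open>card ?I * card ?J\<close> masses by at most
    \<open>\<delta>\<close> costs at most \<open>\<epsilon> / 3\<close> in total.\<close>
  define \<delta> where "\<delta> = \<epsilon> / (3 * (real (card ?I) * real (card ?J)))"
  have card: "0 < real (card ?I) * real (card ?J)" using \<U> \<V> by (simp add: card_Pow)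
  have \<delta>: "0 < \<delta>" using \<epsilon> card by (simp add: \<delta>_def)
  define c where "c p q = max 0 (d p q - \<delta>)" for p q
  have KKm: "K p \<times> K' q \<in> sets L" if "p \<in> ?I" "q \<in> ?J" for p q
    using K[OF that(1)] K'[OF that(2)] compactin_borel_of[OF Z] sL by (simp add: compactin_Times)
  have "disjoint_family_on K ?I" "disjoint_family_on K' ?J"
    using disjoint_family_on_subfamily[OF disjG KG] disjoint_family_on_subfamily[OF disjH KH]
    by blast+
  then have disjKK: "disjoint_family_on (\<lambda>(p, q). K p \<times> K' q) (?I \<times> ?J)"
    by (rule disjoint_family_on_Times)
  have disjGH: "disjoint_family_on (\<lambda>(p, q). G p \<times> H q) (?I \<times> ?J)"
    using disjG disjH by (rule disjoint_family_on_Times)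
  have sumd: "(\<Sum>(p, q)\<in>S. d p q) = measure L (\<Union>(p, q)\<in>S. K p \<times> K' q)" if S: "S \<subseteq> ?I \<times> ?J" for S
  proof -
    have "measure L (\<Union>z\<in>S. (\<lambda>(p, q). K p \<times> K' q) z) = (\<Sum>z\<in>S. measure L ((\<lambda>(p, q). K p \<times> K' q) z))"
      using S fin KKm
      by (intro L.finite_measure_finite_Union)
         (auto intro: finite_subset disjoint_family_on_mono[OF S disjKK])
    then show ?thesis by (simp add: d_def case_prod_unfold)
  qed
  have d_total: "(\<Sum>p\<in>?I. \<Sum>q\<in>?J. d p q) \<le> 1"
    using sumd[of "?I \<times> ?J"] L.prob_le_1 by (simp add: sum.cartesian_product)
  have d_row: "(\<Sum>q\<in>?J. d p q) \<le> measure M (G p)" if p: "p \<in> ?I" for p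
  proof -
    have "(\<Sum>q\<in>?J. d p q) = (\<Sum>(p, q)\<in>{p} \<times> ?J. d p q)"
      by (simp flip: sum.cartesian_product)
    also have "\<dots> = measure L (\<Union>(p, q)\<in>{p} \<times> ?J. K p \<times> K' q)"
      using p by (intro sumd) auto
    also have "\<dots> \<le> measure L (G p \<times> topspace Y)"
      using KG[OF p] compactin_subset_topspace[OF K'] AmL[OF openin_borel_of[OF G[OF p]]]
      by (intro L.finite_measure_mono) auto
    finally show ?thesis using MA[OF openin_borel_of[OF G[OF p]]] by simp
  qed
  have d_col: "(\<Sum>p\<in>?I. d p q) \<le> measure N (H q)" if q: "q \<in> ?J" for q
  proof -
    have "(\<Sum>p\<in>?I. d p q) = (\<Sum>(p, q)\<in>?I \<times> {q}. d p q)"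
      by (simp flip: sum.cartesian_product)
    also have "\<dots> = measure L (\<Union>(p, q)\<in>?I \<times> {q}. K p \<times> K' q)"
      using q by (intro sumd) auto
    also have "\<dots> \<le> measure L (topspace X \<times> H q)"
      using KH[OF q] compactin_subset_topspace[OF K] BmL[OF openin_borel_of[OF H[OF q]]]
      by (intro L.finite_measure_mono) auto
    finally show ?thesis using NB[OF openin_borel_of[OF H[OF q]]] by simp
  qed
  have d_nonneg: "0 \<le> d p q" for p q by (simp add: d_def)
  have trunc_row: "(\<Sum>q\<in>?J. c p q) \<le> max 0 ((\<Sum>q\<in>?J. d p q) - \<delta>)" for p
    unfolding c_def using fin \<delta> d_nonneg by (intro sum_truncated_le) auto
  have trunc_col: "(\<Sum>p\<in>?I. c p q) \<le> max 0 ((\<Sum>p\<in>?I. d p q) - \<delta>)" for q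
    unfolding c_def using fin \<delta> d_nonneg by (intro sum_truncated_le) auto
  have c_total: "(\<Sum>p\<in>?I. \<Sum>q\<in>?J. c p q) < 1"
  proof -
    have "(\<Sum>p\<in>?I. \<Sum>q\<in>?J. c p q) \<le> (\<Sum>p\<in>?I. max 0 ((\<Sum>q\<in>?J. d p q) - \<delta>))"
      by (intro sum_mono trunc_row)
    also have "\<dots> \<le> max 0 ((\<Sum>p\<in>?I. \<Sum>q\<in>?J. d p q) - \<delta>)"
      using fin \<delta> d_nonneg by (intro sum_truncated_le sum_nonneg) auto
    \<comment> \<open>The masses \<open>d p q\<close> may add up to 1; positivity of
      \<open>\<delta>\<close> provides the strict inequality that the coupling requires.\<close>
    also have "\<dots> < 1" using d_total \<delta> by auto
    finally show ?thesis .
  qed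
  have c_captures: "measure L W - \<epsilon> < (\<Sum>(p, q)\<in>{(p, q) \<in> ?I \<times> ?J. G p \<times> H q \<subseteq> W}. c p q)"
    (is "_ < sum _ ?S") if W: "W \<in> set Ws" for W
  proof -
    have S: "?S \<subseteq> ?I \<times> ?J" by auto
    have finS: "finite ?S" using S fin by (meson finite_SigmaI finite_subset)
    let ?D = "\<Union>(p, q)\<in>?S. K p \<times> K' q"
    let ?E = "(topspace X - (\<Union>p\<in>?I. K p)) \<times> topspace Y"
    let ?F = "topspace X \<times> (topspace Y - (\<Union>q\<in>?J. K' q))"
    have Xm: "topspace X - (\<Union>p\<in>?I. K p) \<in> sets (borel_of X)"
      using fin compactin_borel_of[OF X K] openin_borel_of[OF openin_topspace]
      by (intro sets.Diff sets.finite_UN) auto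
    have Ym: "topspace Y - (\<Union>q\<in>?J. K' q) \<in> sets (borel_of Y)"
      using fin compactin_borel_of[OF Y K'] openin_borel_of[OF openin_topspace]
      by (intro sets.Diff sets.finite_UN) auto
    have Dm: "?D \<in> sets L" using finS S KKm by (intro sets.finite_UN) auto
    \<comment> \<open>A point outside \<open>?E\<close> and \<open>?F\<close> lies in some
      \<open>K p \<times> K' q\<close> and in some rectangle
      \<open>U \<times> V \<subseteq> W\<close> of the cover. As \<open>K p\<close> meets
      \<open>U\<close> and \<open>K' q\<close> meets \<open>V\<close>, the whole of
      \<open>G p \<times> H q\<close> lies in \<open>W\<close>.\<close>
    have "C W \<subseteq> ?D \<union> (?E \<union> ?F)"
    proof
      fix z assume z: "z \<in> C W"
      obtain x y where xy: "z = (x, y)" by (cases z)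
      have top: "x \<in> topspace X" "y \<in> topspace Y"
        using compactin_subset_topspace[OF C(1)[OF W]] z xy by auto
      obtain U V where UV: "(U, V) \<in> R W" "x \<in> U" "y \<in> V" using bspec[OF R W] z xy by blast
      have "U \<in> fst ` R W" "V \<in> snd ` R W"
        using imageI[OF UV(1), of fst] imageI[OF UV(1), of snd] by simp_all
      moreover have "U \<times> V \<subseteq> W" using UV(1) bspec[OF R W] by blast
      ultimately have UVW: "U \<in> \<U>" "V \<in> \<V>" "U \<times> V \<subseteq> W"
        using W by (auto simp only: \<U>_def \<V>_def)
      show "z \<in> ?D \<union> (?E \<union> ?F)"
      proof (cases "x \<in> (\<Union>p\<in>?I. K p) \<and> y \<in> (\<Union>q\<in>?J. K' q)")
        case True
        then obtain p q where pq: "p \<in> ?I" "x \<in> K p" "q \<in> ?J" "y \<in> K' q" by blast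
        have "G p \<subseteq> U" "H q \<subseteq> V"
          using bspec[OF bspec[OF GU pq(1)] UVW(1)] bspec[OF bspec[OF HV pq(3)] UVW(2)] pq UV
          by blast+
        then have "(p, q) \<in> ?S" using pq UVW by blast
        then show ?thesis using pq xy by blast
      next
        case False
        then show ?thesis using top xy by blast
      qed
    qed
    then have "measure L (C W) \<le> measure L (?D \<union> (?E \<union> ?F))"
      using Dm AmL[OF Xm] BmL[OF Ym] by (intro L.finite_measure_mono) auto
    also have "\<dots> \<le> measure L ?D + (measure L ?E + measure L ?F)"
      using Dm AmL[OF Xm] BmL[OF Ym]
      by (intro order.trans[OF measure_Un_le] add_left_mono measure_Un_le) auto
    also have "measure L ?E < \<epsilon> / 6" using lossX MA[OF Xm] by simp
    also have "measure L ?F < \<epsilon> / 6" using lossY NB[OF Ym] by simp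
    finally have "measure L (C W) < measure L ?D + \<epsilon> / 3" by simp
    then have "measure L W - 2 * \<epsilon> / 3 < (\<Sum>(p, q)\<in>?S. d p q)"
      using C(3)[OF W] sumd[OF S] by linarith
    also have "\<dots> \<le> (\<Sum>(p, q)\<in>?S. c p q + \<delta>)"
      by (intro sum_mono) (auto simp: c_def)
    also have "\<dots> = (\<Sum>(p, q)\<in>?S. c p q) + real (card ?S) * \<delta>"
      by (simp add: case_prod_unfold sum.distrib)
    also have "real (card ?S) * \<delta> \<le> real (card (?I \<times> ?J)) * \<delta>"
      using card_mono[OF finite_cartesian_product[OF fin] S] less_imp_le[OF \<delta>]
      by (intro mult_right_mono of_nat_mono)
    also have "\<dots> = \<epsilon> / 3"
      using card unfolding \<delta>_def card_cartesian_product of_nat_mult by (simp only: divide_simps) auto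
    finally show ?thesis by simp
  qed

  obtain Gs where Gs: "set Gs = G ` ?I" using fin finite_list by (metis finite_imageI)
  obtain Hs where Hs: "set Hs = H ` ?J" using fin finite_list by (metis finite_imageI)
  show thesis
  proof (rule that[of Gs Hs \<delta>])
    show "openin X U" if "U \<in> set Gs" for U using that Gs G by auto
    show "openin Y V" if "V \<in> set Hs" for V using that Hs H by auto
    show "0 < \<delta>" by (rule \<delta>)
    fix M' N'
    assume "M' \<in> weak_star_basic X (distr L (borel_of X) fst) Gs \<delta>"
      and "N' \<in> weak_star_basic Y (distr L (borel_of Y) snd) Hs \<delta>"
    then have M': "radon_prob X M'" "\<And>p. p \<in> ?I \<Longrightarrow> measure M (G p) - \<delta> < measure M' (G p)"
      and N': "radon_prob Y N'" "\<And>q. q \<in> ?J \<Longrightarrow> measure N (H q) - \<delta> < measure N' (H q)"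
      by (auto simp: weak_star_basic_def PR_def Gs Hs simp flip: M_def N_def)
    \<comment> \<open>The row and column sums of \<open>c\<close> are at most the old marginal
      masses minus \<open>\<delta>\<close>, or zero; the new marginals exceed these bounds or are at
      least nonnegative.\<close>
    have "step_coupling M' N' ?I ?J G H c"
    proof (intro step_coupling.intro step_coupling_axioms.intro)
      show "prob_space M'" "prob_space N'" using M' N' by (auto simp: radon_prob_def)
      show "G p \<in> sets M'" if "p \<in> ?I" for p
        using openin_borel_of[OF G[OF that]] M' by (simp add: radon_prob_def)
      show "H q \<in> sets N'" if "q \<in> ?J" for q
        using openin_borel_of[OF H[OF that]] N' by (simp add: radon_prob_def)
      show "(\<Sum>q\<in>?J. c p q) \<le> measure M' (G p)" if "p \<in> ?I" for p
        using trunc_row[of p] d_row[OF that] M'(2)[OF that] measure_nonneg[of M' "G p"] by linarith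
      show "(\<Sum>p\<in>?I. c p q) \<le> measure N' (H q)" if "q \<in> ?J" for q
        using trunc_col[of q] d_col[OF that] N'(2)[OF that] measure_nonneg[of N' "H q"] by linarith
    qed (use fin disjG disjH c_total in \<open>auto simp: c_def\<close>)
    then obtain L' where L': "radon_prob ?Z L'" "distr L' (borel_of X) fst = M'"
        "distr L' (borel_of Y) snd = N'"
        "\<forall>p\<in>?I. \<forall>q\<in>?J. c p q \<le> measure L' (G p \<times> H q)"
      by (rule radon_coupling_with_rectangles[OF X Y M'(1) N'(1)])
    interpret L': prob_space L' using L' by (simp add: radon_prob_def)
    have opm: "W \<in> sets L'" if "openin ?Z W" for W
      using openin_borel_of[OF that] L'(1) by (simp add: radon_prob_def)
    have "measure L W - \<epsilon> < measure L' W" if W: "W \<in> set Ws" for W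
    proof -
      let ?S = "{(p, q) \<in> ?I \<times> ?J. G p \<times> H q \<subseteq> W}"
      have finS: "finite ?S" by (rule finite_subset[of _ "?I \<times> ?J"]) (use fin in auto)
      have GHm: "G p \<times> H q \<in> sets L'" if "p \<in> ?I" "q \<in> ?J" for p q
        using G[OF that(1)] H[OF that(2)] by (intro opm) (simp add: openin_prod_Times_iff)
      \<comment> \<open>The rectangles inside \<open>W\<close> are disjoint, so the lower bounds for
        their masses under \<open>L'\<close> add up inside \<open>W\<close>.\<close>
      note c_captures[OF W]
      also have "(\<Sum>(p, q)\<in>?S. c p q) \<le> (\<Sum>z\<in>?S. measure L' ((\<lambda>(p, q). G p \<times> H q) z))"
        using L'(4) by (intro sum_mono) auto
      also have "\<dots> = measure L' (\<Union>(p, q)\<in>?S. G p \<times> H q)"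
      proof (rule L'.finite_measure_finite_Union[symmetric, OF finS])
        show "(\<lambda>(p, q). G p \<times> H q) ` ?S \<subseteq> sets L'" using GHm by auto
        show "disjoint_family_on (\<lambda>(p, q). G p \<times> H q) ?S"
          by (rule disjoint_family_on_mono[OF _ disjGH]) auto
      qed
      also have "\<dots> \<le> measure L' W"
        using opm[OF Ws[OF W]] by (intro L'.finite_measure_mono) auto
      finally show ?thesis .
    qed
    then have "L' \<in> weak_star_basic ?Z L Ws \<epsilon>"
      using L'(1) by (simp add: weak_star_basic_def PR_def)
    moreover have "marginals X Y L' = (M', N')"
      using L'(2,3) by (simp add: marginals_def)
    ultimately show "\<exists>L' \<in> weak_star_basic ?Z L Ws \<epsilon>. marginals X Y L' = (M', N')" by blast
  qed
qed

section \<open>Neighbourhoods in the weak-* topology\<close>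

lemma weak_star_basic_mono:
  assumes "set Vs' \<subseteq> set Vs" "\<epsilon> \<le> \<epsilon>'"
  shows "weak_star_basic X M Vs \<epsilon> \<subseteq> weak_star_basic X M Vs' \<epsilon>'"
proof
  fix \<nu> assume \<nu>: "\<nu> \<in> weak_star_basic X M Vs \<epsilon>"
  have "measure M V - \<epsilon>' < measure \<nu> V" if "V \<in> set Vs'" for V
  proof -
    have "measure M V - \<epsilon> < measure \<nu> V" using \<nu> that assms(1) by (auto simp: weak_star_basic_def)
    then show ?thesis using assms(2) by linarith
  qed
  with \<nu> show "\<nu> \<in> weak_star_basic X M Vs' \<epsilon>'" by (auto simp: weak_star_basic_def)
qed

lemma openin_weak_star_basic:
  assumes "M \<in> PR X" "\<And>V. V \<in> set Vs \<Longrightarrow> openin X V" "0 < \<epsilon>"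
  shows "openin (weak_star X) (weak_star_basic X M Vs \<epsilon>)"
  unfolding weak_star_def using assms by (intro topology_generated_by_Basis) blast

text \<open>Sets centred at arbitrary measures generate the topology; here they are recentred at
  \<open>M\<close>. The strict inequalities leave room around \<open>M\<close>, and finite
  intersections are handled by appending lists and taking the smaller tolerance.\<close>

lemma openin_weak_star_contains_basic:
  assumes "openin (weak_star X) S" "M \<in> S"
  shows "M \<in> PR X \<and> (\<exists>Vs \<epsilon>. (\<forall>V\<in>set Vs. openin X V) \<and> 0 < \<epsilon> \<and> weak_star_basic X M Vs \<epsilon> \<subseteq> S)"
proof -
  let ?B = "{weak_star_basic X \<mu> Vs \<epsilon> | \<mu> Vs \<epsilon>. \<mu> \<in> PR X \<and> (\<forall>V \<in> set Vs. openin X V) \<and> \<epsilon> > 0}"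
  have "generate_topology_on ?B S"
    using assms(1) unfolding weak_star_def by (rule openin_topology_generated_by)
  then show ?thesis using assms(2)
  proof induction
    case Empty
    then show ?case by simp
  next
    case (Int S T)
    then obtain Vs \<epsilon> Vs' \<epsilon>' where
      1: "M \<in> PR X" "\<forall>V\<in>set Vs. openin X V" "0 < \<epsilon>" "weak_star_basic X M Vs \<epsilon> \<subseteq> S" and
      2: "\<forall>V\<in>set Vs'. openin X V" "0 < \<epsilon>'" "weak_star_basic X M Vs' \<epsilon>' \<subseteq> T"
      by auto
    have "weak_star_basic X M (Vs @ Vs') (min \<epsilon> \<epsilon>') \<subseteq> weak_star_basic X M Vs \<epsilon> \<inter> weak_star_basic X M Vs' \<epsilon>'"
      by (intro Int_greatest weak_star_basic_mono) auto
    then have "weak_star_basic X M (Vs @ Vs') (min \<epsilon> \<epsilon>') \<subseteq> S \<inter> T" using 1 2 by blast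
    moreover have "\<forall>V\<in>set (Vs @ Vs'). openin X V" "0 < min \<epsilon> \<epsilon>'" using 1 2 by auto
    ultimately show ?case using 1(1) by blast
  next
    case (UN \<S>)
    then obtain S where "S \<in> \<S>" "M \<in> S" by blast
    from UN.IH[OF this] \<open>S \<in> \<S>\<close> show ?case by (meson Union_upper order_trans)
  next
    case (Basis S)
    then obtain \<mu> Vs \<epsilon> where S: "S = weak_star_basic X \<mu> Vs \<epsilon>" "\<forall>V \<in> set Vs. openin X V" by blast
    then have M: "M \<in> PR X" "\<And>V. V \<in> set Vs \<Longrightarrow> measure \<mu> V - \<epsilon> < measure M V"
      using Basis.prems by (auto simp: weak_star_basic_def)
    \<comment> \<open>The least slack of \<open>M\<close> in the finitely many inequalities;
      inserting 1 keeps the minimum defined when \<open>Vs\<close> is empty.\<close>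
    define \<epsilon>' where "\<epsilon>' = Min (insert 1 ((\<lambda>V. measure M V - (measure \<mu> V - \<epsilon>)) ` set Vs))"
    have "0 < \<epsilon>'" unfolding \<epsilon>'_def using M(2) by (subst Min_gr_iff) auto
    moreover have "weak_star_basic X M Vs \<epsilon>' \<subseteq> S"
    proof
      fix \<nu> assume \<nu>: "\<nu> \<in> weak_star_basic X M Vs \<epsilon>'"
      have "measure \<mu> V - \<epsilon> < measure \<nu> V" if "V \<in> set Vs" for V
      proof -
        have "\<epsilon>' \<le> measure M V - (measure \<mu> V - \<epsilon>)"
          unfolding \<epsilon>'_def using that by (intro Min_le) auto
        moreover have "measure M V - \<epsilon>' < measure \<nu> V"
          using \<nu> that by (auto simp: weak_star_basic_def)
        ultimately show ?thesis by linarith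
      qed
      then show "\<nu> \<in> S" using \<nu> S by (auto simp: weak_star_basic_def)
    qed
    ultimately show ?case using M(1) S(2) by blast
  qed
qed

theorem theorem1:
  fixes X :: "'a topology" and Y :: "'b topology"
  assumes "tychonoff_space X" and "tychonoff_space Y"
  shows "open_map (weak_star (prod_topology X Y))
                   (prod_topology (weak_star X) (weak_star Y))
                   (marginals X Y)"
  unfolding open_map_def
proof (intro allI impI)
  let ?Z = "prod_topology X Y"
  have X: "Hausdorff_space X" and Y: "Hausdorff_space Y"
    using assms by (auto simp: tychonoff_space_def)
  fix S assume S: "openin (weak_star ?Z) S"
  show "openin (prod_topology (weak_star X) (weak_star Y)) (marginals X Y ` S)"
    unfolding openin_prod_topology_alt
  proof (intro allI impI)
    fix M N assume "(M, N) \<in> marginals X Y ` S"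
    then obtain L where L: "L \<in> S" "M = distr L (borel_of X) fst" "N = distr L (borel_of Y) snd"
      by (auto simp: marginals_def)
    obtain Ws \<epsilon> where Ws: "L \<in> PR ?Z" "\<forall>W\<in>set Ws. openin ?Z W" "0 < \<epsilon>"
        "weak_star_basic ?Z L Ws \<epsilon> \<subseteq> S"
      using openin_weak_star_contains_basic[OF S L(1)] by blast
    have rL: "radon_prob ?Z L" using Ws(1) by (simp add: PR_def)
    obtain Gs Hs \<delta> where
      Gs: "\<And>G. G \<in> set Gs \<Longrightarrow> openin X G" and Hs: "\<And>H. H \<in> set Hs \<Longrightarrow> openin Y H" and \<delta>: "0 < \<delta>"
      and lift: "\<And>M' N'. M' \<in> weak_star_basic X M Gs \<delta> \<Longrightarrow> N' \<in> weak_star_basic Y N Hs \<delta> \<Longrightarrow>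
         \<exists>L' \<in> weak_star_basic ?Z L Ws \<epsilon>. marginals X Y L' = (M', N')"
      \<comment> \<open>A basic neighbourhood of \<open>L\<close> inside \<open>S\<close> is fed to
        the lifting lemma, so the product of the resulting neighbourhoods of \<open>M\<close> and
        \<open>N\<close> lies in the image of \<open>S\<close>.\<close>
      using marginals_lift_nearby[OF X Y rL _ Ws(3), of Ws] Ws(2) unfolding L(2,3) by blast
    have M: "M \<in> PR X" and N: "N \<in> PR Y"
      unfolding L(2,3) PR_def using X Y rL
      by (auto intro: radon_prob_distr[OF _ continuous_map_fst] radon_prob_distr[OF _ continuous_map_snd])
    show "\<exists>U V. openin (weak_star X) U \<and> openin (weak_star Y) V \<and> M \<in> U \<and> N \<in> V \<and>
        U \<times> V \<subseteq> marginals X Y ` S"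
    proof (intro exI conjI)
      show "openin (weak_star X) (weak_star_basic X M Gs \<delta>)"
        using M Gs \<delta> by (rule openin_weak_star_basic)
      show "openin (weak_star Y) (weak_star_basic Y N Hs \<delta>)"
        using N Hs \<delta> by (rule openin_weak_star_basic)
      show "M \<in> weak_star_basic X M Gs \<delta>" "N \<in> weak_star_basic Y N Hs \<delta>"
        using M N \<delta> by (auto simp: weak_star_basic_def)
      show "weak_star_basic X M Gs \<delta> \<times> weak_star_basic Y N Hs \<delta> \<subseteq> marginals X Y ` S"
      proof clarify
        fix M' N' assume "M' \<in> weak_star_basic X M Gs \<delta>" "N' \<in> weak_star_basic Y N Hs \<delta>"
        then obtain L' where "L' \<in> weak_star_basic ?Z L Ws \<epsilon>" "marginals X Y L' = (M', N')"
          using lift by blast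
        then show "(M', N') \<in> marginals X Y ` S" using Ws(4) by (metis image_eqI subsetD)
      qed
    qed
  qed
qed

end
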